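(* For every $1<q<\infty$, the cardinality of the lattice of closed ideals of $\mathcal L(\ell_1,\ell_q)$ is $2^{2^{\omega}}$. Moreover, the cardinality of the lattice of closed ideals of $\mathcal L\big(\ell_1,(\bigoplus_{n\in\mathbb N}\ell_2^n)_{\mathrm{c}_0}\big)$ is also $2^{2^{\omega}}$.
   Context: For Banach spaces $X,Y$, $\mathcal L(X,Y)$ is the Banach space of bounded linear operators from $X$ to $Y$ with the operator norm, and $\mathcal L(X)=\mathcal L(X,X)$. A closed ideal of $\mathcal L(X,Y)$ is a norm-closed linear subspace $\mathcal J\subset\mathcal L(X,Y)$ such that $ASB\in\mathcal J$ whenever $S\in\mathcal J$, $A\in\mathcal L(Y)$ and $B\in\mathcal L(X)$. The closed ideals of $\mathcal L(X,Y)$, ordered by inclusion, form a lattice; its cardinality is the number of closed ideals. $\ell_2^{n}$ is $n$-dimensional Euclidean space, and $(\bigoplus_{n}\ell_2^{n})_{\mathrm{c}_0}$ is the space of sequences $(x_n)$ with $x_n\in\ell_2^{n}$ and $\|x_n\|\to0$, equipped with the norm $\sup_n\|x_n\|$. $2^\omega$ denotes the cardinality of the continuum, and $2^{2^\omega}$ the cardinality of its power set. *)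

theory Defs
  imports
    "HOL-Analysis.L2_Norm"
    "HOL-Library.FuncSet"
    "HOL-Library.Equipollence"
begin

text \<open>
  The exponent \<open>q\<close> of \<open>\<ell>\<^sub>q\<close> is a real variable of the theorem, so normed spaces over the
  scalar field \<open>'k\<close> are records with explicit carrier rather than types.
\<close>

record ('k, 'v) nspace =
  nv_carrier :: "'v set"
  nv_add :: "'v \<Rightarrow> 'v \<Rightarrow> 'v"
  nv_scale :: "'k \<Rightarrow> 'v \<Rightarrow> 'v"
  nv_norm :: "'v \<Rightarrow> real"

definition nv_dist :: "('k::real_normed_field, 'v) nspace \<Rightarrow> 'v \<Rightarrow> 'v \<Rightarrow> real" where
  "nv_dist X x y = nv_norm X (nv_add X x (nv_scale X (- 1) y))"

definition bounded_operator ::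
    "('k::real_normed_field, 'v) nspace \<Rightarrow> ('k, 'w) nspace \<Rightarrow> ('v \<Rightarrow> 'w) \<Rightarrow> bool" where
  "bounded_operator X Y T \<longleftrightarrow>
     (\<forall>x\<in>nv_carrier X. T x \<in> nv_carrier Y) \<and>
     (\<forall>x\<in>nv_carrier X. \<forall>y\<in>nv_carrier X. T (nv_add X x y) = nv_add Y (T x) (T y)) \<and>
     (\<forall>c. \<forall>x\<in>nv_carrier X. T (nv_scale X c x) = nv_scale Y c (T x)) \<and>
     (\<exists>K. \<forall>x\<in>nv_carrier X. nv_norm Y (T x) \<le> K * nv_norm X x)"

text \<open>
  Operators are required to be \<open>extensional\<close> (\<open>undefined\<close> off the carrier of \<open>X\<close>), so that
  equality of operators is equality as maps on \<open>X\<close>; otherwise the closed ideals could not be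
  counted correctly.
\<close>

definition operator_space ::
    "('k::real_normed_field, 'v) nspace \<Rightarrow> ('k, 'w) nspace \<Rightarrow> ('k, 'v \<Rightarrow> 'w) nspace" where
  "operator_space X Y =
     \<lparr> nv_carrier = {T \<in> extensional (nv_carrier X). bounded_operator X Y T},
       nv_add = (\<lambda>S T. \<lambda>x\<in>nv_carrier X. nv_add Y (S x) (T x)),
       nv_scale = (\<lambda>c T. \<lambda>x\<in>nv_carrier X. nv_scale Y c (T x)),
       nv_norm = (\<lambda>T. SUP x\<in>{x \<in> nv_carrier X. nv_norm X x \<le> 1}. nv_norm Y (T x)) \<rparr>"

definition linear_subspace :: "('k::real_normed_field, 'v) nspace \<Rightarrow> 'v set \<Rightarrow> bool" where
  "linear_subspace X U \<longleftrightarrow>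
     U \<subseteq> nv_carrier X \<and> U \<noteq> {} \<and>
     (\<forall>x\<in>U. \<forall>y\<in>U. nv_add X x y \<in> U) \<and>
     (\<forall>c. \<forall>x\<in>U. nv_scale X c x \<in> U)"

definition norm_closed :: "('k::real_normed_field, 'v) nspace \<Rightarrow> 'v set \<Rightarrow> bool" where
  "norm_closed X U \<longleftrightarrow>
     (\<forall>u x. (\<forall>n::nat. u n \<in> U) \<and> x \<in> nv_carrier X \<and> (\<lambda>n. nv_dist X (u n) x) \<longlonglongrightarrow> 0 \<longrightarrow> x \<in> U)"

definition closed_ideals ::
    "('k::real_normed_field, 'v) nspace \<Rightarrow> ('k, 'w) nspace \<Rightarrow> ('v \<Rightarrow> 'w) set set" where
  "closed_ideals X Y =
     {J. linear_subspace (operator_space X Y) J \<and> norm_closed (operator_space X Y) J \<and>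
         (\<forall>S\<in>J. \<forall>A\<in>nv_carrier (operator_space Y Y). \<forall>B\<in>nv_carrier (operator_space X X).
            compose (nv_carrier X) A (compose (nv_carrier X) S B) \<in> J)}"

definition ell :: "real \<Rightarrow> ('k::real_normed_field, nat \<Rightarrow> 'k) nspace" where
  "ell q =
     \<lparr> nv_carrier = {x. summable (\<lambda>i. norm (x i) powr q)},
       nv_add = (\<lambda>x y i. x i + y i),
       nv_scale = (\<lambda>c x i. c * x i),
       nv_norm = (\<lambda>x. (\<Sum>i. norm (x i) powr q) powr (1 / q)) \<rparr>"

text \<open>\<open>\<ell>\<^sub>2\<^sup>n\<close>: the coordinates are those with index below \<open>n\<close>, the sequence is padded by \<open>0\<close>.\<close>

definition ell2_fin :: "nat \<Rightarrow> ('k::real_normed_field, nat \<Rightarrow> 'k) nspace" where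
  "ell2_fin n =
     \<lparr> nv_carrier = {x. \<forall>i\<ge>n. x i = 0},
       nv_add = (\<lambda>x y i. x i + y i),
       nv_scale = (\<lambda>c x i. c * x i),
       nv_norm = (\<lambda>x. L2_set (\<lambda>i. norm (x i)) {..<n}) \<rparr>"

definition c0_sum ::
    "(nat \<Rightarrow> ('k::real_normed_field, 'v) nspace) \<Rightarrow> ('k, nat \<Rightarrow> 'v) nspace" where
  "c0_sum X =
     \<lparr> nv_carrier = {x. (\<forall>n. x n \<in> nv_carrier (X n)) \<and> (\<lambda>n. nv_norm (X n) (x n)) \<longlonglongrightarrow> 0},
       nv_add = (\<lambda>x y n. nv_add (X n) (x n) (y n)),
       nv_scale = (\<lambda>c x n. nv_scale (X n) c (x n)),
       nv_norm = (\<lambda>x. SUP n. nv_norm (X n) (x n)) \<rparr>"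

end

theory Submission
  imports Defs "HOL-Analysis.Analysis"
begin

text \<open>
  Idea: an operator on \<open>\<ell>\<^sub>1\<close> is an arbitrary bounded sequence in \<open>Y\<close>. For each \<open>n\<close> take a huge number
  \<open>N n\<close> of almost disjoint \<open>k n\<close>-element sets \<open>G n i\<close> (graphs of polynomials) of coordinates in the
  \<open>n\<close>-th block of \<open>Y\<close>. For \<open>B \<subseteq> \<nat>\<close> let \<open>T\<^sub>B\<close> send the unit vectors to the normalised indicators of the
  sets \<open>G m i\<close>, \<open>m \<in> B\<close>. An operator \<open>S\<close> is small along \<open>A\<close> if, for every \<open>U\<close> on \<open>Y\<close>, all but a vanishing
  proportion of the normalised functionals \<open>y \<mapsto> \<Sum>c\<in>G n j. y c\<close>, \<open>j < N n\<close>, are uniformly small on the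
  image of the unit ball under \<open>U S\<close>, as \<open>n \<rightarrow> \<infinity>\<close> in \<open>A\<close>. These operators form a closed ideal, which
  does not contain \<open>T\<^sub>A\<close> if \<open>A\<close> is infinite.

  It contains \<open>T\<^sub>B\<close> if \<open>A \<inter> B\<close> is finite: a vector of given norm has only boundedly many large averages
  over almost disjoint sets. This shows that each \<open>y\<close> is seen by few of the functionals of block \<open>n\<close>,
  and, applied in the dual, that all but a bounded number of the vectors from later blocks are mapped by
  \<open>U\<close> to something negligible in block \<open>n\<close>. Earlier blocks contain few vectors compared with \<open>N n\<close>.
  Intersecting these ideals over subfamilies of an almost disjoint family of size continuum gives
  \<open>2\<^bsup>2\<^sup>\<omega>\<^esup>\<close> closed ideals, and there are no more because there are only continuum many operators.
\<close>

subsection \<open>Averages over almost disjoint sets\<close>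

text \<open>Convexity of \<open>\<lambda>x. x powr p\<close> applied to the mean of the
  \<open>x i\<close>; it is Hoelder's inequality against a constant function.\<close>

lemma power_mean:
  fixes x :: "'a \<Rightarrow> real"
  assumes "1 < p" "finite A" "\<And>i. i \<in> A \<Longrightarrow> 0 \<le> x i"
  shows "(\<Sum>i\<in>A. x i) powr p \<le> real (card A) powr (p - 1) * (\<Sum>i\<in>A. x i powr p)"
proof -
  \<comment> \<open>Convexity is used on the positive reals, so zero entries are set aside first;
    dropping them only lowers the cardinality.\<close>
  define B where "B = {i \<in> A. 0 < x i}"
  have fin: "finite B" and sub: "B \<subseteq> A"
    using assms(2) by (auto simp: B_def)
  have sumx: "(\<Sum>i\<in>A. x i) = (\<Sum>i\<in>B. x i)" and sump: "(\<Sum>i\<in>A. x i powr p) = (\<Sum>i\<in>B. x i powr p)"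
    using assms by (force intro!: sum.mono_neutral_right simp: B_def)+
  show ?thesis
  proof (cases "B = {}")
    case True
    then show ?thesis by (simp add: sumx sump)
  next
    case False
    define b where "b = real (card B)"
    have b: "0 < b" using False fin by (simp add: b_def card_gt_0_iff)
    have "(\<Sum>i\<in>B. (1 / b) *\<^sub>R x i) powr p \<le> (\<Sum>i\<in>B. (1 / b) * x i powr p)"
      using b False assms(1) fin
      by (intro convex_on_sum[OF fin False powr_convex]) (auto simp: b_def B_def)
    then have "((\<Sum>i\<in>B. x i) / b) powr p \<le> (\<Sum>i\<in>B. x i powr p) / b"
      by (simp add: sum_divide_distrib)
    moreover have "((\<Sum>i\<in>B. x i) / b) powr p = (\<Sum>i\<in>B. x i) powr p / b powr p"
      by (simp add: powr_divide)
    ultimately have "(\<Sum>i\<in>B. x i) powr p \<le> b powr p * ((\<Sum>i\<in>B. x i powr p) / b)"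
      using b by (simp add: field_simps)
    also have "\<dots> = b powr (p - 1) * (\<Sum>i\<in>B. x i powr p)"
      using b by (simp add: powr_diff)
    also have "\<dots> \<le> real (card A) powr (p - 1) * (\<Sum>i\<in>B. x i powr p)"
      using assms(1,2) sub
      by (intro mult_right_mono powr_mono2) (auto simp: b_def card_mono intro: sum_nonneg)
    finally show ?thesis by (simp add: sumx sump)
  qed
qed

text \<open>Removing the other sets costs \<open>G i\<close> at most \<open>r * card I\<close>
  points, each with a value of norm at most \<open>K\<close>. By the hypothesis on \<open>k\<close>
  this loss is at most half of the lower bound for the sum over \<open>G i\<close>. So each of the
  disjoint remainders \<open>H i\<close> carries \<open>p\<close>-mass at least
  \<open>(\<epsilon> / 2) powr p\<close>, while all of them together carry at most
  \<open>K powr p\<close>.\<close>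

lemma few_large_averages:
  fixes \<phi> :: "'c \<Rightarrow> 'k::real_normed_field" and k :: "'i \<Rightarrow> nat"
  assumes p: "1 < p" and conj: "1 / p + 1 / p' = 1"
    and fin: "finite I"
    and G: "\<And>i. i \<in> I \<Longrightarrow> finite (G i) \<and> card (G i) = k i \<and> 0 < k i \<and> G i \<subseteq> D"
    and meet: "\<And>i j. i \<in> I \<Longrightarrow> j \<in> I \<Longrightarrow> i \<noteq> j \<Longrightarrow> card (G i \<inter> G j) \<le> r"
    and \<phi>: "\<And>F. finite F \<Longrightarrow> F \<subseteq> D \<Longrightarrow> (\<Sum>c\<in>F. norm (\<phi> c) powr p) \<le> K powr p" and K: "0 \<le> K"
    and \<epsilon>: "0 < \<epsilon>"
    and large: "\<And>i. i \<in> I \<Longrightarrow> \<epsilon> * real (k i) powr (1 / p') \<le> norm (\<Sum>c\<in>G i. \<phi> c)"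
    and k: "\<And>i. i \<in> I \<Longrightarrow> real (r * card I) * K \<le> \<epsilon> / 2 * real (k i) powr (1 / p')"
  shows "real (card I) * (\<epsilon> / 2) powr p \<le> K powr p"
proof -
  define H where "H i = G i - (\<Union>j\<in>I - {i}. G j)" for i
  have pt: "norm (\<phi> c) \<le> K" if "c \<in> D" for c
  proof -
    have "norm (\<phi> c) powr p \<le> K powr p" using \<phi>[of "{c}"] that by simp
    then show ?thesis using p K by (smt (verit) norm_ge_zero powr_less_mono2)
  qed
  have *: "(\<epsilon> / 2) powr p \<le> (\<Sum>c\<in>H i. norm (\<phi> c) powr p)" if i: "i \<in> I" for i
  proof -
    have finG: "finite (G i)" using G[OF i] by simp
    have kpos: "0 < real (k i)" using G[OF i] by simp
    have "card (G i - H i) = card (\<Union>j\<in>I - {i}. G i \<inter> G j)"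
      by (rule arg_cong[of _ _ card]) (auto simp: H_def)
    also have "\<dots> \<le> (\<Sum>j\<in>I - {i}. card (G i \<inter> G j))"
      using fin by (intro card_UN_le) auto
    also have "\<dots> \<le> (\<Sum>j\<in>I - {i}. r)"
      using meet i by (intro sum_mono) auto
    also have "\<dots> \<le> r * card I"
      using fin by (simp add: card_Diff1_le)
    finally have c: "card (G i - H i) \<le> r * card I" .
    have "norm (\<Sum>c\<in>G i - H i. \<phi> c) \<le> (\<Sum>c\<in>G i - H i. K)"
      using G[OF i] by (intro sum_norm_le pt) auto
    also have "\<dots> \<le> real (r * card I) * K"
      using c K by (simp add: mult_right_mono flip: of_nat_mult)
    also have "\<dots> \<le> \<epsilon> / 2 * real (k i) powr (1 / p')" by (rule k[OF i])
    finally have small: "norm (\<Sum>c\<in>G i - H i. \<phi> c) \<le> \<epsilon> / 2 * real (k i) powr (1 / p')" .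
    have "(\<Sum>c\<in>G i. \<phi> c) = (\<Sum>c\<in>G i - H i. \<phi> c) + (\<Sum>c\<in>H i. \<phi> c)"
      using finG by (intro sum.subset_diff) (auto simp: H_def)
    then have "norm (\<Sum>c\<in>G i. \<phi> c) \<le> norm (\<Sum>c\<in>G i - H i. \<phi> c) + norm (\<Sum>c\<in>H i. \<phi> c)"
      by (metis norm_triangle_ineq)
    with small large[OF i] have "\<epsilon> / 2 * real (k i) powr (1 / p') \<le> norm (\<Sum>c\<in>H i. \<phi> c)"
      by simp
    also have "\<dots> \<le> (\<Sum>c\<in>H i. norm (\<phi> c))" by (rule norm_sum)
    finally have "(\<epsilon> / 2 * real (k i) powr (1 / p')) powr p \<le> (\<Sum>c\<in>H i. norm (\<phi> c)) powr p"
      using p \<epsilon> by (intro powr_mono2) auto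
    also have "\<dots> \<le> real (card (H i)) powr (p - 1) * (\<Sum>c\<in>H i. norm (\<phi> c) powr p)"
      using p finG by (intro power_mean) (auto simp: H_def)
    also have "\<dots> \<le> real (k i) powr (p - 1) * (\<Sum>c\<in>H i. norm (\<phi> c) powr p)"
      using p G[OF i] card_mono[OF finG, of "H i"]
      by (intro mult_right_mono powr_mono2) (auto simp: H_def intro: sum_nonneg)
    finally have "(\<epsilon> / 2) powr p * real (k i) powr (1 / p' * p)
        \<le> real (k i) powr (p - 1) * (\<Sum>c\<in>H i. norm (\<phi> c) powr p)"
      using \<epsilon> by (simp only: powr_mult powr_powr)
    \<comment> \<open>Hence the powers of \<open>k i\<close> on both sides cancel and the bound is
      free of the size of the sets.\<close>
    moreover have "1 / p' * p = p - 1"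
    proof -
      have "1 / p' = 1 - 1 / p" using conj by simp
      then show ?thesis using p by (simp add: field_simps)
    qed
    ultimately show ?thesis using kpos by (simp add: mult.commute)
  qed
  have "real (card I) * (\<epsilon> / 2) powr p \<le> (\<Sum>i\<in>I. \<Sum>c\<in>H i. norm (\<phi> c) powr p)"
    using sum_mono[OF *] by simp
  also have "\<dots> = (\<Sum>c\<in>(\<Union>i\<in>I. H i). norm (\<phi> c) powr p)"
    using fin G by (intro sum.UNION_disjoint[symmetric]) (auto simp: H_def)
  also have "\<dots> \<le> K powr p"
    using fin G by (intro \<phi>) (auto simp: H_def)
  finally show ?thesis .
qed

text \<open>The count in terms of natural numbers. More than \<open>a ^ e\<close> indices would
  contain a set \<open>J\<close> of exactly \<open>a ^ e + 1\<close>; the bound on \<open>k\<close>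
  supplies the overlap condition of \<open>few_large_averages\<close> for \<open>J\<close>, and its
  conclusion \<open>card J \<le> (2 * K / \<epsilon>) powr p \<le> a ^ e\<close> is absurd. Passing
  to \<open>J\<close> also gives finiteness of \<open>I\<close>.\<close>

lemma finite_card_large_averages:
  fixes \<phi> :: "'c \<Rightarrow> 'k::real_normed_field" and k :: "'i \<Rightarrow> nat"
  assumes p: "1 < p" and conj: "1 / p + 1 / p' = 1"
    and G: "\<And>i. i \<in> I \<Longrightarrow> finite (G i) \<and> card (G i) = k i \<and> 0 < k i \<and> G i \<subseteq> D"
    and meet: "\<And>i j. i \<in> I \<Longrightarrow> j \<in> I \<Longrightarrow> i \<noteq> j \<Longrightarrow> card (G i \<inter> G j) \<le> r"
    and \<phi>: "\<And>F. finite F \<Longrightarrow> F \<subseteq> D \<Longrightarrow> (\<Sum>c\<in>F. norm (\<phi> c) powr p) \<le> K powr p" and K: "0 < K"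
    and \<epsilon>: "0 < \<epsilon>"
    and large: "\<And>i. i \<in> I \<Longrightarrow> \<epsilon> * real (k i) powr (1 / p') \<le> norm (\<Sum>c\<in>G i. \<phi> c)"
    and a: "2 * K / \<epsilon> \<le> real a" and e: "p \<le> real e" "p' \<le> real e" "0 < p'"
    and k: "\<And>i. i \<in> I \<Longrightarrow> (r * (a ^ e + 1) * a) ^ e \<le> k i"
  shows "finite I \<and> card I \<le> a ^ e"
proof (rule ccontr)
  assume "\<not> ?thesis"
  then have "infinite I \<or> a ^ e + 1 \<le> card I" by auto
  then obtain J where J: "J \<subseteq> I" "finite J" "card J = a ^ e + 1"
    by (meson infinite_arbitrarily_large obtain_subset_with_card_n)
  have apos: "1 \<le> real a"
  proof -
    have "0 < real a" using a K \<epsilon> by (meson divide_pos_pos less_le_trans mult_pos_pos zero_less_numeral)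
    then show ?thesis by simp
  qed
  have "real (card J) * (\<epsilon> / 2) powr p \<le> K powr p"
  proof (rule few_large_averages[OF p conj J(2), where G = G and k = k and D = D and r = r and \<phi> = \<phi>])
    fix i assume i: "i \<in> J"
    \<comment> \<open>The hypothesis on \<open>k\<close> reads \<open>?b ^ e \<le> k i\<close>;
      since \<open>p' \<le> e\<close>, it yields \<open>?b \<le> k i powr (1 / p')\<close>.\<close>
    let ?b = "r * (a ^ e + 1) * a"
    have "real ?b powr p' \<le> real ?b ^ e"
    proof (cases "?b = 0")
      case True
      then show ?thesis by (simp only: of_nat_0 powr_zero_eq_one) simp
    next
      case False
      then have "1 \<le> real ?b" by linarith
      then have "real ?b powr p' \<le> real ?b powr real e" using e by (intro powr_mono) auto
      then show ?thesis using \<open>1 \<le> real ?b\<close> by (simp add: powr_realpow)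
    qed
    also have "\<dots> \<le> real (k i)" using k[of i] i J(1) by (metis of_nat_le_iff of_nat_power subsetD)
    finally have "(real ?b powr p') powr (1 / p') \<le> real (k i) powr (1 / p')"
      using e by (intro powr_mono2) auto
    then have b: "real ?b \<le> real (k i) powr (1 / p')"
      using e by (simp add: powr_powr)
    have "real (r * card J) * K = real (r * (a ^ e + 1)) * (\<epsilon> / 2) * (2 * K / \<epsilon>)"
      using \<epsilon> J(3) by (simp add: field_simps)
    also have "\<dots> \<le> real (r * (a ^ e + 1)) * (\<epsilon> / 2) * real a"
      using \<epsilon> by (intro mult_left_mono a) auto
    also have "\<dots> = \<epsilon> / 2 * real ?b" by simp
    also have "\<dots> \<le> \<epsilon> / 2 * real (k i) powr (1 / p')"
      using \<epsilon> b by (intro mult_left_mono) auto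
    finally show "real (r * card J) * K \<le> \<epsilon> / 2 * real (k i) powr (1 / p')" .
  qed (use G meet \<phi> K \<epsilon> large J(1) in \<open>auto simp: subset_iff\<close>)
  then have "real (card J) \<le> (2 * K / \<epsilon>) powr p"
    using \<epsilon> K by (simp add: powr_divide powr_mult field_simps)
  also have "\<dots> \<le> real a powr p"
    using p K \<epsilon> by (intro powr_mono2 a) auto
  also have "\<dots> \<le> real a powr real e"
    using e apos by (intro powr_mono) auto
  also have "\<dots> = real (a ^ e)"
    using apos by (simp add: powr_realpow)
  finally show False using J(3) by linarith
qed

section \<open>Graphs of polynomials as almost disjoint sets\<close>

text \<open>The difference is a nonzero integer polynomial of degree at most \<open>r\<close>.
  Extensionality of the coefficient functions ensures that different ones differ at an index up to
  \<open>r\<close>.\<close>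

lemma card_agreements_le:
  fixes c c' :: "nat \<Rightarrow> nat"
  assumes "c \<in> {..r} \<rightarrow>\<^sub>E A" "c' \<in> {..r} \<rightarrow>\<^sub>E A" "c \<noteq> c'"
  shows "card {x::nat. (\<Sum>i\<le>r. c i * x ^ i) = (\<Sum>i\<le>r. c' i * x ^ i)} \<le> r
    \<and> finite {x::nat. (\<Sum>i\<le>r. c i * x ^ i) = (\<Sum>i\<le>r. c' i * x ^ i)}"
proof -
  define P :: "int poly" where "P = (\<Sum>i\<le>r. monom (int (c i) - int (c' i)) i)"
  obtain i where i: "i \<le> r" "c i \<noteq> c' i"
    using assms by (metis PiE_ext atMost_iff)
  have co: "coeff P j = (if j \<le> r then int (c j) - int (c' j) else 0)" for j
    by (simp add: P_def coeff_sum)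
  have "P \<noteq> 0" using i co[of i] by auto
  have deg: "degree P \<le> r" by (rule degree_le) (simp add: co)
  have ev: "poly P (int x) = int (\<Sum>i\<le>r. c i * x ^ i) - int (\<Sum>i\<le>r. c' i * x ^ i)" for x
    by (simp add: P_def poly_sum poly_monom left_diff_distrib sum_subtractf)
  let ?S = "{x::nat. (\<Sum>i\<le>r. c i * x ^ i) = (\<Sum>i\<le>r. c' i * x ^ i)}"
  have sub: "int ` ?S \<subseteq> {z. poly P z = 0}" unfolding image_def by (auto simp only: ev)
  have fin: "finite {z. poly P z = 0}" using \<open>P \<noteq> 0\<close> by (rule poly_roots_finite)
  have "card ?S = card (int ` ?S)" by (simp add: card_image)
  also have "\<dots> \<le> r"
    using card_mono[OF fin sub] card_poly_roots_bound[OF \<open>P \<noteq> 0\<close>] deg by linarith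
  finally show ?thesis
    using finite_subset[OF sub fin] by (simp add: finite_image_iff)
qed

text \<open>The sets are graphs over \<open>{..<k}\<close> of polynomials of degree at most
  \<open>e + 1\<close> with coefficients below \<open>L\<close>, so two of them share at most
  \<open>e + 1\<close> points. There are \<open>L ^ (e + 2)\<close> of them, while \<open>d\<close>
  grows only linearly in \<open>L\<close>. The required lower bound for \<open>N\<close> therefore
  grows like \<open>L ^ (e + 1)\<close> and is met once \<open>L\<close> is large.\<close>

lemma ex_almost_disjoint_sets:
  fixes b e :: nat
  shows "\<exists>k d N. \<exists>G :: nat \<Rightarrow> nat set. b \<le> k \<and> 0 < k \<and> 0 < N \<and> (b + d * (b * d) ^ e) * b ^ (e + 1) \<le> N
     \<and> (\<forall>i<N. G i \<subseteq> {..<d} \<and> card (G i) = k)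
     \<and> (\<forall>i<N. \<forall>j<N. i \<noteq> j \<longrightarrow> card (G i \<inter> G j) \<le> e + 1)"
proof -
  define r where "r = e + 1"
  define k where "k = b + 1"
  \<comment> \<open>\<open>C\<close> will satisfy \<open>d \<le> C * L\<close> and does not involve
    \<open>L\<close>; this allows \<open>L\<close> to be chosen just above the factor that remains
    in front of \<open>L ^ (e + 1)\<close>.\<close>
  define C where "C = k * ((r + 1) * k ^ r + 1)"
  define L where "L = (b + C * (b * C) ^ e) * b ^ (e + 1) + 1"
  define V where "V = (r + 1) * (L * k ^ r) + 1"
  define d where "d = k * V"
  define N where "N = L ^ (r + 1)"
  let ?P = "{..r} \<rightarrow>\<^sub>E {..<L}"
  have L: "1 \<le> L" by (simp add: L_def)
  have "card ?P = N" by (simp add: card_PiE N_def)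
  then obtain f where f: "bij_betw f {..<N} ?P"
    using ex_bij_betw_nat_finite[of ?P] by (auto simp: finite_PiE atLeast0LessThan)
  define g where "g i x = (\<Sum>l\<le>r. f i l * x ^ l)" for i x
  \<comment> \<open>The point \<open>(x, g i x)\<close> of the graph is coded as
    \<open>x * V + g i x\<close>; all values are below \<open>V\<close>, so division by
    \<open>V\<close> recovers both parts.\<close>
  define G where "G i = (\<lambda>x. x * V + g i x) ` {..<k}" for i
  have gV: "g i x < V" if "i < N" "x < k" for i x
  proof -
    have fi: "f i \<in> ?P" using f that by (auto simp: bij_betw_def)
    have "g i x \<le> (\<Sum>l\<le>r. L * k ^ r)"
      unfolding g_def
    proof (intro sum_mono mult_mono)
      fix l assume l: "l \<in> {..r}"
      show "f i l \<le> L" using fi l by (auto simp: PiE_iff less_imp_le)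
      have "x ^ l \<le> k ^ l" using that by (intro power_mono) auto
      also have "\<dots> \<le> k ^ r" using l by (intro power_increasing) (auto simp: k_def)
      finally show "x ^ l \<le> k ^ r" .
    qed auto
    then show ?thesis by (simp add: V_def)
  qed
  have dec: "(x * V + g i x) div V = x \<and> (x * V + g i x) mod V = g i x" if "i < N" "x < k" for i x
    using gV[OF that] by simp
  have Gd: "G i \<subseteq> {..<d}" if "i < N" for i
  proof -
    have "x * V + g i x < d" if "x < k" for x
    proof -
      have "x * V + g i x < (x + 1) * V" using gV[OF \<open>i < N\<close> that] by simp
      also have "\<dots> \<le> d" unfolding d_def using that by (intro mult_right_mono) auto
      finally show ?thesis .
    qed
    then show ?thesis by (auto simp: G_def)
  qed
  have Gk: "card (G i) = k" if "i < N" for i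
    unfolding G_def using dec[OF that] by (subst card_image) (auto intro!: inj_onI, metis)
  have meet: "card (G i \<inter> G j) \<le> e + 1" if ij: "i < N" "j < N" "i \<noteq> j" for i j
  proof -
    have "f i \<in> ?P" "f j \<in> ?P" "f i \<noteq> f j"
      using f ij by (auto simp: bij_betw_def inj_on_def)
    note agree = card_agreements_le[OF this]
    have "G i \<inter> G j \<subseteq> (\<lambda>x. x * V + g i x) ` {x. g i x = g j x}"
    proof
      fix y assume "y \<in> G i \<inter> G j"
      then obtain x x' where x: "x < k" "y = x * V + g i x" and x': "x' < k" "y = x' * V + g j x'"
        by (auto simp: G_def)
      then show "y \<in> (\<lambda>x. x * V + g i x) ` {x. g i x = g j x}"
        using dec[of i x] dec[of j x'] ij by (intro image_eqI[of _ _ x]) auto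
    qed
    then have "card (G i \<inter> G j) \<le> card {x. g i x = g j x}"
      using agree by (intro surj_card_le) (auto simp: g_def)
    also have "\<dots> \<le> e + 1" using agree by (simp add: g_def r_def)
    finally show ?thesis .
  qed
  have dC: "d \<le> C * L"
  proof -
    have "V \<le> ((r + 1) * k ^ r + 1) * L" using L by (simp add: V_def algebra_simps)
    then have "k * V \<le> k * (((r + 1) * k ^ r + 1) * L)" by (rule mult_left_mono) simp
    then show ?thesis unfolding d_def C_def by (simp only: mult.assoc)
  qed
  have "b + d * (b * d) ^ e \<le> b + (C * L) * (b * (C * L)) ^ e"
    using dC by (intro add_left_mono mult_mono power_mono) auto
  also have "\<dots> = b + C * (b * C) ^ e * L ^ (e + 1)"
    by (simp add: power_mult_distrib algebra_simps)
  also have "\<dots> \<le> (b + C * (b * C) ^ e) * L ^ (e + 1)"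
    using L by (simp add: algebra_simps)
  finally have "(b + d * (b * d) ^ e) * b ^ (e + 1) \<le> (b + C * (b * C) ^ e) * L ^ (e + 1) * b ^ (e + 1)"
    by (rule mult_right_mono) simp
  also have "\<dots> \<le> L * L ^ (e + 1)"
    by (simp add: L_def algebra_simps)
  also have "\<dots> = N" by (simp add: N_def r_def)
  finally have "(b + d * (b * d) ^ e) * b ^ (e + 1) \<le> N" .
  moreover have "0 < N" using L by (simp add: N_def)
  ultimately show ?thesis using Gd Gk meet
    by (intro exI[of _ k] exI[of _ d] exI[of _ N] exI[of _ G]) (auto simp: k_def)
qed

subsection \<open>Operators on sequence spaces\<close>

text \<open>The record has no zero vector and no negation; they appear as multiples by
  \<open>0\<close> and \<open>- 1\<close>.\<close>

locale normed_nspace =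
  fixes X :: "('k::real_normed_field, 'v) nspace"
  assumes carrier_nonempty: "nv_carrier X \<noteq> {}"
    and add_closed: "x \<in> nv_carrier X \<Longrightarrow> y \<in> nv_carrier X \<Longrightarrow> nv_add X x y \<in> nv_carrier X"
    and scale_closed: "x \<in> nv_carrier X \<Longrightarrow> nv_scale X c x \<in> nv_carrier X"
    and add_commute: "x \<in> nv_carrier X \<Longrightarrow> y \<in> nv_carrier X \<Longrightarrow> nv_add X x y = nv_add X y x"
    and add_assoc: "x \<in> nv_carrier X \<Longrightarrow> y \<in> nv_carrier X \<Longrightarrow> z \<in> nv_carrier X \<Longrightarrow>
      nv_add X (nv_add X x y) z = nv_add X x (nv_add X y z)"
    and scale_add_right: "x \<in> nv_carrier X \<Longrightarrow> y \<in> nv_carrier X \<Longrightarrow>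
      nv_scale X c (nv_add X x y) = nv_add X (nv_scale X c x) (nv_scale X c y)"
    and scale_add_left: "x \<in> nv_carrier X \<Longrightarrow>
      nv_scale X (a + b) x = nv_add X (nv_scale X a x) (nv_scale X b x)"
    and scale_scale: "x \<in> nv_carrier X \<Longrightarrow> nv_scale X a (nv_scale X b x) = nv_scale X (a * b) x"
    and norm_triangle: "x \<in> nv_carrier X \<Longrightarrow> y \<in> nv_carrier X \<Longrightarrow>
      nv_norm X (nv_add X x y) \<le> nv_norm X x + nv_norm X y"
    and norm_scale: "x \<in> nv_carrier X \<Longrightarrow> nv_norm X (nv_scale X c x) = norm c * nv_norm X x"
    and norm_nonneg: "x \<in> nv_carrier X \<Longrightarrow> 0 \<le> nv_norm X x"

text \<open>The scalar field is a type and not an \<open>nspace\<close> record, so functionals have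
  a predicate of their own. The bound \<open>K\<close> is explicit because the counts below depend
  on it.\<close>

definition bounded_functional :: "('k::real_normed_field, 'v) nspace \<Rightarrow> real \<Rightarrow> ('v \<Rightarrow> 'k) \<Rightarrow> bool" where
  "bounded_functional X K f \<longleftrightarrow>
     (\<forall>x\<in>nv_carrier X. \<forall>y\<in>nv_carrier X. f (nv_add X x y) = f x + f y) \<and>
     (\<forall>c. \<forall>x\<in>nv_carrier X. f (nv_scale X c x) = c * f x) \<and>
     (\<forall>x\<in>nv_carrier X. norm (f x) \<le> K * nv_norm X x)"

lemma bounded_functionalD:
  assumes "bounded_functional X K f"
  shows "x \<in> nv_carrier X \<Longrightarrow> y \<in> nv_carrier X \<Longrightarrow> f (nv_add X x y) = f x + f y"
    and "x \<in> nv_carrier X \<Longrightarrow> f (nv_scale X c x) = c * f x"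
    and "x \<in> nv_carrier X \<Longrightarrow> norm (f x) \<le> K * nv_norm X x"
  using assms by (auto simp: bounded_functional_def)

lemma bounded_operatorD:
  assumes "bounded_operator X Y T"
  shows "x \<in> nv_carrier X \<Longrightarrow> T x \<in> nv_carrier Y"
    and "x \<in> nv_carrier X \<Longrightarrow> y \<in> nv_carrier X \<Longrightarrow> T (nv_add X x y) = nv_add Y (T x) (T y)"
    and "x \<in> nv_carrier X \<Longrightarrow> T (nv_scale X c x) = nv_scale Y c (T x)"
  using assms by (auto simp: bounded_operator_def)

text \<open>A constant of at least 1 can be divided by, and dividing a threshold by it does not
  raise the threshold.\<close>

lemma bounded_operator_bound:
  assumes "bounded_operator X Y T" "normed_nspace X"
  obtains K where "1 \<le> K" "\<And>x. x \<in> nv_carrier X \<Longrightarrow> nv_norm Y (T x) \<le> K * nv_norm X x"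
proof -
  interpret X: normed_nspace X by fact
  obtain K where K: "\<And>x. x \<in> nv_carrier X \<Longrightarrow> nv_norm Y (T x) \<le> K * nv_norm X x"
    using assms(1) unfolding bounded_operator_def by blast
  have "nv_norm Y (T x) \<le> max 1 K * nv_norm X x" if "x \<in> nv_carrier X" for x
    using K[OF that] mult_right_mono[OF max.cobounded2[of K 1] X.norm_nonneg[OF that]] by linarith
  then show ?thesis by (intro that[of "max 1 K"]) auto
qed

lemma bounded_operator_compose:
  assumes "bounded_operator X Y S" "bounded_operator Y Z T" "normed_nspace Y"
  shows "bounded_operator X Z (\<lambda>x. T (S x))"
proof -
  obtain K where K: "\<And>x. x \<in> nv_carrier X \<Longrightarrow> nv_norm Y (S x) \<le> K * nv_norm X x"
    using assms(1) unfolding bounded_operator_def by blast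
  obtain L where L: "1 \<le> L" "\<And>y. y \<in> nv_carrier Y \<Longrightarrow> nv_norm Z (T y) \<le> L * nv_norm Y y"
    using bounded_operator_bound[OF assms(2,3)] by blast
  have "nv_norm Z (T (S x)) \<le> (L * K) * nv_norm X x" if "x \<in> nv_carrier X" for x
  proof -
    have "nv_norm Z (T (S x)) \<le> L * nv_norm Y (S x)"
      using L bounded_operatorD(1)[OF assms(1) that] by blast
    also have "\<dots> \<le> L * (K * nv_norm X x)" using L K[OF that] by (intro mult_left_mono) auto
    finally show ?thesis by (simp add: mult.assoc)
  qed
  then show ?thesis
    using assms(1,2) unfolding bounded_operator_def by metis
qed

lemma bounded_functional_compose:
  assumes S: "bounded_operator X Y S" and f: "bounded_functional Y K f"
    and L: "\<And>x. x \<in> nv_carrier X \<Longrightarrow> nv_norm Y (S x) \<le> L * nv_norm X x" and "0 \<le> K"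
  shows "bounded_functional X (K * L) (\<lambda>x. f (S x))"
  unfolding bounded_functional_def
proof (intro conjI ballI allI)
  fix x assume x: "x \<in> nv_carrier X"
  have "norm (f (S x)) \<le> K * nv_norm Y (S x)"
    using bounded_functionalD(3)[OF f] bounded_operatorD(1)[OF S x] by blast
  also have "\<dots> \<le> K * (L * nv_norm X x)" by (intro mult_left_mono L x assms)
  finally show "norm (f (S x)) \<le> K * L * nv_norm X x" by (simp add: mult.assoc)
qed (auto simp: bounded_functionalD[OF f] bounded_operatorD[OF S])

section \<open>The spaces \<open>ell q\<close>\<close>

lemma ell_simps:
  "nv_carrier (ell q) = {x. summable (\<lambda>i. norm (x i) powr q)}"
  "nv_add (ell q) = (\<lambda>x y i. x i + y i)"
  "nv_scale (ell q) = (\<lambda>c x i. c * x i)"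
  "nv_norm (ell q) = (\<lambda>x. (\<Sum>i. norm (x i) powr q) powr (1 / q))"
  by (simp_all add: ell_def)

text \<open>\<open>(s + t) / (a + b)\<close> is the mean of \<open>s / a\<close> and
  \<open>t / b\<close> with weights proportional to \<open>a\<close> and \<open>b\<close>. This is
  the pointwise form of Minkowski's inequality; zero values are treated apart, as in
  \<open>power_mean\<close>.\<close>

lemma powr_convex_combination:
  fixes a b s t q :: real
  assumes q: "1 \<le> q" and ab: "0 < a" "0 < b" and st: "0 \<le> s" "0 \<le> t"
  shows "((s + t) / (a + b)) powr q \<le> a / (a + b) * (s / a) powr q + b / (a + b) * (t / b) powr q"
proof -
  have scaled: "(t / (a + b)) powr q \<le> b / (a + b) * (t / b) powr q" if "0 < a" "0 < b" "0 \<le> t" for a b t :: real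
  proof -
    have "(t / (a + b)) powr q = (b / (a + b)) powr q * (t / b) powr q"
      using that by (simp add: powr_divide)
    also have "\<dots> \<le> (b / (a + b)) powr 1 * (t / b) powr q"
      using that q by (intro mult_right_mono powr_mono') auto
    finally show ?thesis using that by simp
  qed
  show ?thesis
  proof (cases "s = 0 \<or> t = 0")
    case True
    then show ?thesis using scaled[of a b t] scaled[of b a s] assms by (auto simp: add.commute)
  next
    case False
    have "((b / (a + b)) *\<^sub>R (t / b) + (a / (a + b)) *\<^sub>R (s / a)) = (s + t) / (a + b)"
      using ab by (simp add: add_divide_distrib)
    moreover have "1 - b / (a + b) = a / (a + b)" using ab by (simp add: field_simps)
    ultimately show ?thesis
      using convex_onD[OF powr_convex[OF q], of "b / (a + b)" "s / a" "t / b"] False assms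
      by (simp add: add.commute)
  qed
qed

text \<open>Once both vectors are normalised by their bounds, summing the convexity estimate over
  the coordinates leaves the two weights, which add up to 1.\<close>

lemma minkowski_finite:
  fixes x y :: "'a \<Rightarrow> 'b::real_normed_vector"
  assumes q: "1 \<le> q" and ab: "0 < a" "0 < b"
    and x: "(\<Sum>i\<in>A. norm (x i) powr q) \<le> a powr q" and y: "(\<Sum>i\<in>A. norm (y i) powr q) \<le> b powr q"
  shows "(\<Sum>i\<in>A. norm (x i + y i) powr q) \<le> (a + b) powr q"
proof -
  have "(\<Sum>i\<in>A. norm (x i + y i) powr q) / (a + b) powr q = (\<Sum>i\<in>A. (norm (x i + y i) / (a + b)) powr q)"
    by (simp add: sum_divide_distrib powr_divide)
  also have "\<dots> \<le> (\<Sum>i\<in>A. ((norm (x i) + norm (y i)) / (a + b)) powr q)"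
    using q ab by (intro sum_mono powr_mono2 divide_right_mono norm_triangle_ineq) auto
  also have "\<dots> \<le> (\<Sum>i\<in>A. a / (a + b) * (norm (x i) / a) powr q + b / (a + b) * (norm (y i) / b) powr q)"
    using q ab by (intro sum_mono powr_convex_combination) auto
  also have "\<dots> = a / (a + b) * ((\<Sum>i\<in>A. norm (x i) powr q) / a powr q)
      + b / (a + b) * ((\<Sum>i\<in>A. norm (y i) powr q) / b powr q)"
    by (simp add: sum.distrib sum_divide_distrib powr_divide sum_distrib_left)
  also have "\<dots> \<le> a / (a + b) * 1 + b / (a + b) * 1"
    using x y ab by (intro add_mono mult_left_mono) (auto simp: divide_le_eq)
  also have "\<dots> = 1" using ab by (simp flip: add_divide_distrib)
  finally show ?thesis using ab by (simp add: divide_le_eq)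
qed

text \<open>Reduces membership and norm bound together to finite sums, on which the later estimates
  are made.\<close>

lemma ell_norm_le_iff:
  assumes q: "0 < q" and a: "0 \<le> a"
  shows "x \<in> nv_carrier (ell q) \<and> nv_norm (ell q) x \<le> a \<longleftrightarrow> (\<forall>n. (\<Sum>i<n. norm (x i) powr q) \<le> a powr q)"
proof -
  have powr: "s powr (1 / q) \<le> a \<longleftrightarrow> s \<le> a powr q" if "0 \<le> s" for s
  proof -
    have "s powr (1 / q) \<le> a \<longleftrightarrow> (s powr (1 / q)) powr q \<le> a powr q"
      using q a that powr_mono_both powr_less_mono2[of q a "s powr (1 / q)"] powr_mono2[of q "s powr (1 / q)" a]
      by (meson less_imp_le not_le powr_ge_zero)
    then show ?thesis using q that by (simp add: powr_powr)
  qed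
  show ?thesis
  proof (intro iffI allI)
    fix n assume "x \<in> nv_carrier (ell q) \<and> nv_norm (ell q) x \<le> a"
    then have sm: "summable (\<lambda>i. norm (x i) powr q)" and "(\<Sum>i. norm (x i) powr q) \<le> a powr q"
      using powr[OF suminf_nonneg, of "\<lambda>i. norm (x i) powr q"] by (auto simp: ell_simps)
    moreover have "(\<Sum>i<n. norm (x i) powr q) \<le> (\<Sum>i. norm (x i) powr q)"
      by (intro sum_le_suminf sm) auto
    ultimately show "(\<Sum>i<n. norm (x i) powr q) \<le> a powr q" by simp
  next
    assume le: "\<forall>n. (\<Sum>i<n. norm (x i) powr q) \<le> a powr q"
    then have sm: "summable (\<lambda>i. norm (x i) powr q)"
      by (intro summableI_nonneg_bounded[of _ "a powr q"]) auto
    then have "(\<Sum>i. norm (x i) powr q) \<le> a powr q"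
      using le by (intro suminf_le_const) auto
    then show "x \<in> nv_carrier (ell q) \<and> nv_norm (ell q) x \<le> a"
      using sm powr[OF suminf_nonneg, of "\<lambda>i. norm (x i) powr q"] by (auto simp: ell_simps)
  qed
qed

lemma ell_sum_le:
  assumes q: "0 < q" and x: "x \<in> nv_carrier (ell q)" and A: "finite A"
  shows "(\<Sum>i\<in>A. norm (x i) powr q) \<le> nv_norm (ell q) x powr q"
proof -
  have nn: "0 \<le> nv_norm (ell q) x" by (simp add: ell_simps)
  obtain n where n: "A \<subseteq> {..<n}" using A finite_nat_iff_bounded by blast
  have "(\<Sum>i\<in>A. norm (x i) powr q) \<le> (\<Sum>i<n. norm (x i) powr q)"
    using n by (intro sum_mono2) auto
  also have "\<dots> \<le> nv_norm (ell q) x powr q"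
    using ell_norm_le_iff[OF q nn, of x] x by auto
  finally show ?thesis .
qed

lemma ell_coordinate_le:
  assumes q: "0 < q" and x: "x \<in> nv_carrier (ell q)"
  shows "norm (x i) \<le> nv_norm (ell q) x"
proof (rule ccontr)
  assume "\<not> ?thesis"
  then have "nv_norm (ell q) x powr q < norm (x i) powr q"
    using q by (intro powr_less_mono2) (auto simp: ell_simps)
  then show False using ell_sum_le[OF q x, of "{i}"] by simp
qed

lemma ell_add:
  fixes x y :: "nat \<Rightarrow> 'k::real_normed_field"
  assumes q: "1 \<le> q" and x: "x \<in> nv_carrier (ell q)" "nv_norm (ell q) x \<le> a"
    and y: "y \<in> nv_carrier (ell q)" "nv_norm (ell q) y \<le> b"
  shows "nv_add (ell q) x y \<in> nv_carrier (ell q) \<and> nv_norm (ell q) (nv_add (ell q) x y) \<le> a + b"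
proof -
  have nn: "0 \<le> a" "0 \<le> b" using x(2) y(2) by (auto simp: ell_simps intro: order_trans[OF powr_ge_zero])
  \<comment> \<open>\<open>minkowski_finite\<close> asks for positive bounds, so both bounds are
    raised by \<open>\<delta>\<close>, which is sent to 0 at the end.\<close>
  have *: "nv_add (ell q) x y \<in> nv_carrier (ell q) \<and> nv_norm (ell q) (nv_add (ell q) x y) \<le> (a + \<delta>) + (b + \<delta>)"
    if \<delta>: "0 < \<delta>" for \<delta>
  proof -
    have "0 < q" "0 < a + \<delta>" "0 < b + \<delta>" using nn \<delta> q by auto
    moreover have "x \<in> nv_carrier (ell q) \<and> nv_norm (ell q) x \<le> a + \<delta>"
      "y \<in> nv_carrier (ell q) \<and> nv_norm (ell q) y \<le> b + \<delta>"
      using x y \<delta> by auto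
    ultimately show ?thesis
      using minkowski_finite[OF q, of "a + \<delta>" "b + \<delta>" x _ y]
      by (subst (asm) (1 2) ell_norm_le_iff, simp_all) (subst ell_norm_le_iff, auto simp: ell_simps)
  qed
  have "nv_norm (ell q) (nv_add (ell q) x y) \<le> a + b"
  proof (rule field_le_epsilon)
    fix \<epsilon> :: real assume "0 < \<epsilon>"
    then show "nv_norm (ell q) (nv_add (ell q) x y) \<le> a + b + \<epsilon>" using *[of "\<epsilon> / 2"] by simp
  qed
  then show ?thesis using *[of 1] by simp
qed

lemma normed_nspace_ell:
  assumes q: "1 \<le> q"
  shows "normed_nspace (ell q :: ('k::real_normed_field, nat \<Rightarrow> 'k) nspace)"
proof
  let ?E = "ell q :: ('k, nat \<Rightarrow> 'k) nspace"
  have "(\<lambda>_. 0) \<in> nv_carrier ?E" using q by (simp add: ell_simps)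
  then show "nv_carrier ?E \<noteq> {}" by blast
  fix x y assume x: "x \<in> nv_carrier ?E" and y: "y \<in> nv_carrier ?E"
  show "nv_add ?E x y \<in> nv_carrier ?E" "nv_norm ?E (nv_add ?E x y) \<le> nv_norm ?E x + nv_norm ?E y"
    using ell_add[OF q x order_refl y order_refl] by auto
next
  let ?E = "ell q :: ('k, nat \<Rightarrow> 'k) nspace"
  fix x c assume x: "x \<in> nv_carrier ?E"
  then have s: "(\<lambda>i. norm (c * x i) powr q) sums (norm c powr q * (\<Sum>i. norm (x i) powr q))"
    by (auto simp: ell_simps norm_mult powr_mult intro: sums_mult)
  then show "nv_scale ?E c x \<in> nv_carrier ?E"
    by (auto simp: ell_simps sums_iff)
  show "nv_norm ?E (nv_scale ?E c x) = norm c * nv_norm ?E x"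
    using s q by (simp add: ell_simps sums_iff powr_mult powr_powr)
qed (auto simp: ell_simps algebra_simps)

lemma ell_one_carrier: "nv_carrier (ell 1) = {x. summable (\<lambda>i. norm (x i))}"
  by (simp add: ell_simps)

lemma ell_one_norm: "x \<in> nv_carrier (ell 1) \<Longrightarrow> nv_norm (ell 1) x = (\<Sum>i. norm (x i))"
  by (simp add: ell_simps suminf_nonneg)

section \<open>Unit vectors and operators on \<open>ell 1\<close>\<close>

definition unit_seq :: "nat \<Rightarrow> nat \<Rightarrow> 'k::real_normed_field" where
  "unit_seq l = (\<lambda>i. if i = l then 1 else 0)"

lemma unit_seq_ell:
  assumes "0 < q"
  shows "(unit_seq l :: nat \<Rightarrow> 'k::real_normed_field) \<in> nv_carrier (ell q)"
    and "nv_norm (ell q) (unit_seq l :: nat \<Rightarrow> 'k) = 1"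
proof -
  have *: "(\<lambda>i. norm (unit_seq l i :: 'k) powr q) = (\<lambda>i. if i = l then 1 else 0)"
    by (auto simp: unit_seq_def)
  show "(unit_seq l :: nat \<Rightarrow> 'k) \<in> nv_carrier (ell q)" "nv_norm (ell q) (unit_seq l :: nat \<Rightarrow> 'k) = 1"
    using sums_single[of l "\<lambda>_. 1::real"] * by (simp_all add: ell_simps sums_iff)
qed

text \<open>Split \<open>v\<close> into a head \<open>h n\<close> and a tail \<open>t n\<close>:
  linearity bounds \<open>g\<close> on the head by the values at unit vectors, and boundedness makes
  the tail contribute a null sequence. This replaces suprema over the unit ball by suprema over the
  unit vectors.\<close>

lemma ell_one_functional_le:
  fixes g :: "(nat \<Rightarrow> 'k::real_normed_field) \<Rightarrow> 'k"
  assumes g: "bounded_functional (ell 1) C g"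
    and unit: "\<And>l. norm (g (unit_seq l)) \<le> \<delta>" and v: "v \<in> nv_carrier (ell 1)"
  shows "norm (g v) \<le> \<delta> * nv_norm (ell 1) v"
proof -
  define h where "h n = (\<lambda>i. if i < n then v i else 0)" for n
  define t where "t n = (\<lambda>i. if i < n then 0 else v i)" for n
  have sv: "summable (\<lambda>i. norm (v i))" using v by (simp add: ell_one_carrier)
  have h: "h n \<in> nv_carrier (ell 1)" for n
    using summable_If_finite_set[of "{..<n}" "\<lambda>i. norm (v i)"]
    by (simp add: ell_one_carrier h_def if_distrib cong: if_cong)
  have unit1: "unit_seq l \<in> nv_carrier (ell 1 :: ('k, nat \<Rightarrow> 'k) nspace)" for l
    by (simp add: unit_seq_ell)
  interpret normed_nspace "ell 1 :: ('k, nat \<Rightarrow> 'k) nspace" by (rule normed_nspace_ell) simp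
  have tn: "(\<lambda>i. norm (t n i)) sums ((\<Sum>i. norm (v i)) - (\<Sum>i<n. norm (v i)))" for n
  proof -
    have "(\<lambda>i. norm (v i) - (if i \<in> {..<n} then norm (v i) else 0)) sums
        ((\<Sum>i. norm (v i)) - (\<Sum>i<n. norm (v i)))"
      by (intro sums_diff summable_sums[OF sv] sums_If_finite_set) simp
    moreover have "(\<lambda>i. norm (v i) - (if i \<in> {..<n} then norm (v i) else 0)) = (\<lambda>i. norm (t n i))"
      by (auto simp: t_def)
    ultimately show ?thesis by simp
  qed
  then have t: "t n \<in> nv_carrier (ell 1)"
    and nt: "nv_norm (ell 1) (t n) = (\<Sum>i. norm (v i)) - (\<Sum>i<n. norm (v i))" for n
    by (auto simp: ell_one_carrier ell_one_norm sums_iff)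
  have gh: "norm (g (h n)) \<le> (\<Sum>i<n. norm (v i) * \<delta>)" for n
  proof (induction n)
    case 0
    have "h 0 = nv_scale (ell 1) 0 (unit_seq 0)" by (auto simp: h_def ell_simps)
    then show ?case using bounded_functionalD(2)[OF g unit1, of 0 0] by simp
  next
    case (Suc n)
    have "h (Suc n) = nv_add (ell 1) (h n) (nv_scale (ell 1) (v n) (unit_seq n))"
      by (auto simp: h_def ell_simps unit_seq_def less_Suc_eq)
    then have "g (h (Suc n)) = g (h n) + v n * g (unit_seq n)"
      using bounded_functionalD(1,2)[OF g] h unit1 scale_closed by metis
    then have "norm (g (h (Suc n))) \<le> norm (g (h n)) + norm (v n) * norm (g (unit_seq n))"
      by (metis norm_mult norm_triangle_ineq)
    also have "\<dots> \<le> (\<Sum>i<n. norm (v i) * \<delta>) + norm (v n) * \<delta>"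
      by (intro add_mono mult_left_mono Suc unit) auto
    finally show ?case by simp
  qed
  have "norm (g v) \<le> \<delta> * nv_norm (ell 1) v + C * ((\<Sum>i. norm (v i)) - (\<Sum>i<n. norm (v i)))" for n
  proof -
    have "v = nv_add (ell 1) (h n) (t n)" by (auto simp: h_def t_def ell_simps)
    then have "norm (g v) \<le> norm (g (h n)) + norm (g (t n))"
      using bounded_functionalD(1)[OF g h t] by (metis norm_triangle_ineq)
    also have "\<dots> \<le> (\<Sum>i<n. norm (v i)) * \<delta> + C * nv_norm (ell 1) (t n)"
      using gh[of n] bounded_functionalD(3)[OF g t] by (simp add: sum_distrib_right add_mono)
    also have "\<dots> \<le> nv_norm (ell 1) v * \<delta> + C * nv_norm (ell 1) (t n)"
    proof -
      have "0 \<le> \<delta>" using unit norm_ge_zero order_trans by blast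
      then show ?thesis
        using sv by (auto simp: ell_one_norm[OF v] intro!: mult_right_mono sum_le_suminf)
    qed
    finally show ?thesis by (simp add: nt mult.commute)
  qed
  moreover have "(\<lambda>n. \<delta> * nv_norm (ell 1) v + C * ((\<Sum>i. norm (v i)) - (\<Sum>i<n. norm (v i))))
      \<longlonglongrightarrow> \<delta> * nv_norm (ell 1) v + C * ((\<Sum>i. norm (v i)) - (\<Sum>i. norm (v i)))"
    by (intro tendsto_intros summable_LIMSEQ sv)
  ultimately show ?thesis by (auto intro: LIMSEQ_le_const)
qed

lemma in_operator_space:
  "T \<in> nv_carrier (operator_space X Y) \<longleftrightarrow> T \<in> extensional (nv_carrier X) \<and> bounded_operator X Y T"
  by (simp add: operator_space_def)

lemma bounded_operator_restrict:
  assumes "normed_nspace X"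
  shows "bounded_operator X Y (restrict T (nv_carrier X)) \<longleftrightarrow> bounded_operator X Y T"
proof -
  interpret normed_nspace X by fact
  show ?thesis using add_closed scale_closed by (simp add: bounded_operator_def)
qed

text \<open>The operator on \<open>ell 1\<close> that sends the unit vector with index
  \<open>l\<close> to \<open>y l\<close>. The series is summed in each coordinate, so that no
  convergence in the target space enters the definition.\<close>

definition synthesis :: "(nat \<Rightarrow> nat \<Rightarrow> 'k::real_normed_field) \<Rightarrow> (nat \<Rightarrow> 'k) \<Rightarrow> nat \<Rightarrow> 'k" where
  "synthesis y v = (\<lambda>c. \<Sum>l. v l * y l c)"

lemma synthesis_summable:
  fixes y :: "nat \<Rightarrow> nat \<Rightarrow> 'k::{real_normed_field, banach}"
  assumes "\<And>l. norm (y l c) \<le> 1" "v \<in> nv_carrier (ell 1)"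
  shows "summable (\<lambda>l. v l * y l c)"
proof (rule summable_comparison_test)
  show "\<exists>N. \<forall>l\<ge>N. norm (v l * y l c) \<le> norm (v l)"
    using assms(1) by (simp add: norm_mult mult_left_le)
qed (use assms(2) in \<open>simp add: ell_one_carrier\<close>)

lemma synthesis_unit_seq: "synthesis y (unit_seq l) = y l"
proof
  fix c
  have "(\<lambda>l'. unit_seq l l' * y l' c) = (\<lambda>l'. if l' = l then y l' c else 0)"
    by (auto simp: unit_seq_def)
  then show "synthesis y (unit_seq l) c = y l c"
    using sums_single[of l "\<lambda>l'. y l' c"] by (simp add: synthesis_def sums_iff)
qed

lemma synthesis_linear:
  fixes y :: "nat \<Rightarrow> nat \<Rightarrow> 'k::{real_normed_field, banach}"
  assumes "\<And>l. norm (y l c) \<le> 1" "v \<in> nv_carrier (ell 1)"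
  shows "w \<in> nv_carrier (ell 1) \<Longrightarrow> synthesis y (\<lambda>i. v i + w i) c = synthesis y v c + synthesis y w c"
    and "synthesis y (\<lambda>i. a * v i) c = a * synthesis y v c"
proof -
  note sm = synthesis_summable[of y c, OF assms(1)]
  show "synthesis y (\<lambda>i. v i + w i) c = synthesis y v c + synthesis y w c" if "w \<in> nv_carrier (ell 1)"
    using suminf_add[OF sm[OF assms(2)] sm[OF that]] by (simp add: synthesis_def distrib_right)
  show "synthesis y (\<lambda>i. a * v i) c = a * synthesis y v c"
    using suminf_mult[OF sm[OF assms(2)], of a] by (simp add: synthesis_def mult.assoc)
qed

text \<open>The finite sums over \<open>l < L\<close> obey the triangle inequality in
  \<open>ell q\<close>. On finitely many coordinates the estimate survives the limit in
  \<open>L\<close>, and \<open>ell_norm_le_iff\<close> passes to all coordinates.\<close>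

lemma ell_synthesis:
  fixes y :: "nat \<Rightarrow> nat \<Rightarrow> 'k::{real_normed_field, banach}"
  assumes q: "1 \<le> q" and y: "\<And>l. y l \<in> nv_carrier (ell q) \<and> nv_norm (ell q) (y l) \<le> 1"
    and v: "v \<in> nv_carrier (ell 1)"
  shows "synthesis y v \<in> nv_carrier (ell q) \<and> nv_norm (ell q) (synthesis y v) \<le> nv_norm (ell 1) v"
proof -
  have nn: "0 \<le> nv_norm (ell 1) v" and q0: "0 < q" using q by (simp_all add: ell_simps)
  interpret normed_nspace "ell q :: ('k, nat \<Rightarrow> 'k) nspace" by (rule normed_nspace_ell[OF q])
  have y1: "norm (y l c) \<le> 1" for l c
    using ell_coordinate_le[OF q0, of "y l" c] y[of l] by linarith
  have partial: "(\<lambda>c. \<Sum>l<L. v l * y l c) \<in> nv_carrier (ell q) \<and>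
      nv_norm (ell q) (\<lambda>c. \<Sum>l<L. v l * y l c) \<le> (\<Sum>l<L. norm (v l))" for L
  proof (induction L)
    case 0
    then show ?case using q by (simp add: ell_simps)
  next
    case (Suc L)
    have "nv_scale (ell q) (v L) (y L) \<in> nv_carrier (ell q)"
      "nv_norm (ell q) (nv_scale (ell q) (v L) (y L)) \<le> norm (v L)"
      using scale_closed norm_scale y[of L] by (auto intro: mult_left_le)
    from ell_add[OF q _ _ this, of "\<lambda>c. \<Sum>l<L. v l * y l c"] Suc
    show ?case by (auto simp: ell_simps)
  qed
  have "(\<Sum>c<n. norm (synthesis y v c) powr q) \<le> nv_norm (ell 1) v powr q" for n
  proof (rule LIMSEQ_le_const2)
    show "(\<lambda>L. \<Sum>c<n. norm (\<Sum>l<L. v l * y l c) powr q) \<longlonglongrightarrow> (\<Sum>c<n. norm (synthesis y v c) powr q)"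
      unfolding synthesis_def using q0
      by (intro tendsto_sum tendsto_powr2 tendsto_norm summable_LIMSEQ synthesis_summable y1 v) auto
    have "(\<Sum>l<L. norm (v l)) \<le> nv_norm (ell 1) v" for L
      using v by (auto simp: ell_one_norm ell_one_carrier intro: sum_le_suminf)
    then have "\<forall>n. (\<Sum>c<n. norm (\<Sum>l<L. v l * y l c) powr q) \<le> nv_norm (ell 1) v powr q" for L
      using partial[of L] order_trans by (subst ell_norm_le_iff[OF q0 nn, symmetric]) blast
    then show "\<exists>N. \<forall>L\<ge>N. (\<Sum>c<n. norm (\<Sum>l<L. v l * y l c) powr q) \<le> nv_norm (ell 1) v powr q"
      by blast
  qed
  then show ?thesis by (subst ell_norm_le_iff[OF q0 nn]) blast
qed

lemma ell_ex_operator: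
  fixes y :: "nat \<Rightarrow> nat \<Rightarrow> 'k::{real_normed_field, banach}"
  assumes q: "1 \<le> q" and y: "\<And>l. y l \<in> nv_carrier (ell q) \<and> nv_norm (ell q) (y l) \<le> 1"
  shows "\<exists>T\<in>nv_carrier (operator_space (ell 1) (ell q)). \<forall>l. T (unit_seq l) = y l"
proof -
  have n1: "normed_nspace (ell 1 :: ('k, nat \<Rightarrow> 'k) nspace)" by (rule normed_nspace_ell) simp
  have y1: "norm (y l c) \<le> 1" for l c
    using ell_coordinate_le[of q "y l" c] y[of l] q by linarith
  have "bounded_operator (ell 1) (ell q) (synthesis y)"
    unfolding bounded_operator_def
    using ell_synthesis[OF q y] y1
    by (auto simp: ell_simps(2,3) synthesis_linear intro!: exI[of _ 1])
  then have "restrict (synthesis y) (nv_carrier (ell 1)) \<in> nv_carrier (operator_space (ell 1) (ell q))"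
    by (simp add: in_operator_space bounded_operator_restrict[OF n1])
  then show ?thesis
    by (intro bexI) (auto simp: synthesis_unit_seq unit_seq_ell)
qed

section \<open>c0-sums of Euclidean spaces\<close>

lemma ell2_fin_simps:
  "nv_carrier (ell2_fin n) = {x. \<forall>i\<ge>n. x i = 0}"
  "nv_add (ell2_fin n) = (\<lambda>x y i. x i + y i)"
  "nv_scale (ell2_fin n) = (\<lambda>c x i. c * x i)"
  "nv_norm (ell2_fin n) = (\<lambda>x. L2_set (\<lambda>i. norm (x i)) {..<n})"
  by (simp_all add: ell2_fin_def)

lemma normed_nspace_ell2_fin: "normed_nspace (ell2_fin n :: ('k::real_normed_field, nat \<Rightarrow> 'k) nspace)"
proof
  let ?E = "ell2_fin n :: ('k, nat \<Rightarrow> 'k) nspace"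
  have "(\<lambda>_. 0) \<in> nv_carrier ?E" by (simp add: ell2_fin_simps)
  then show "nv_carrier ?E \<noteq> {}" by blast
  fix x y :: "nat \<Rightarrow> 'k"
  have "L2_set (\<lambda>i. norm (x i + y i)) {..<n} \<le> L2_set (\<lambda>i. norm (x i) + norm (y i)) {..<n}"
    by (intro L2_set_mono norm_triangle_ineq) auto
  also have "\<dots> \<le> L2_set (\<lambda>i. norm (x i)) {..<n} + L2_set (\<lambda>i. norm (y i)) {..<n}"
    by (rule L2_set_triangle_ineq)
  finally show "nv_norm ?E (nv_add ?E x y) \<le> nv_norm ?E x + nv_norm ?E y"
    by (simp add: ell2_fin_simps)
  show "nv_norm ?E (nv_scale ?E c x) = norm c * nv_norm ?E x" for c
    by (simp add: ell2_fin_simps norm_mult L2_set_right_distrib)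
qed (auto simp: ell2_fin_simps algebra_simps L2_set_nonneg)

lemma c0_sum_simps:
  "nv_carrier (c0_sum X) = {x. (\<forall>n. x n \<in> nv_carrier (X n)) \<and> (\<lambda>n. nv_norm (X n) (x n)) \<longlonglongrightarrow> 0}"
  "nv_add (c0_sum X) = (\<lambda>x y n. nv_add (X n) (x n) (y n))"
  "nv_scale (c0_sum X) = (\<lambda>c x n. nv_scale (X n) c (x n))"
  "nv_norm (c0_sum X) = (\<lambda>x. SUP n. nv_norm (X n) (x n))"
  by (simp_all add: c0_sum_def)

lemma c0_sum_block_le:
  assumes "x \<in> nv_carrier (c0_sum X)"
  shows "nv_norm (X n) (x n) \<le> nv_norm (c0_sum X) x"
proof -
  have "Bseq (\<lambda>n. nv_norm (X n) (x n))"
    using assms by (intro convergent_imp_Bseq) (auto simp: c0_sum_simps convergent_def)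
  then have "bdd_above (range (\<lambda>n. nv_norm (X n) (x n)))" by (rule Bseq_bdd_above)
  then show ?thesis by (auto simp: c0_sum_simps intro: cSUP_upper)
qed

lemma c0_sum_norm_le: "(\<And>n. nv_norm (X n) (x n) \<le> a) \<Longrightarrow> nv_norm (c0_sum X) x \<le> a"
  by (auto simp: c0_sum_simps intro: cSUP_least)

lemma normed_nspace_c0_sum:
  fixes X :: "nat \<Rightarrow> ('k::real_normed_field, 'v) nspace"
  assumes "\<And>n. normed_nspace (X n)"
  shows "normed_nspace (c0_sum X)"
proof -
  interpret X: normed_nspace "X n" for n by (rule assms)
  show ?thesis
  proof
    have "\<exists>z. z \<in> nv_carrier (X n) \<and> nv_norm (X n) z = 0" for n
      using X.carrier_nonempty X.scale_closed X.norm_scale[of _ n 0] by fastforce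
    then obtain z where "\<And>n. z n \<in> nv_carrier (X n) \<and> nv_norm (X n) (z n) = 0" by metis
    then have "z \<in> nv_carrier (c0_sum X)" by (simp add: c0_sum_simps)
    then show "nv_carrier (c0_sum X) \<noteq> {}" by blast
  next
    fix x y assume x: "x \<in> nv_carrier (c0_sum X)" and y: "y \<in> nv_carrier (c0_sum X)"
    have xn: "x n \<in> nv_carrier (X n)" "y n \<in> nv_carrier (X n)" for n
      using x y by (auto simp: c0_sum_simps)
    have "(\<lambda>n. nv_norm (X n) (nv_add (X n) (x n) (y n))) \<longlonglongrightarrow> 0"
    proof (rule tendsto_sandwich[OF always_eventually always_eventually tendsto_const])
      show "(\<lambda>n. nv_norm (X n) (x n) + nv_norm (X n) (y n)) \<longlonglongrightarrow> 0"
        using x y by (auto simp: c0_sum_simps intro: tendsto_add_zero)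
    qed (use xn X.norm_nonneg X.add_closed X.norm_triangle in auto)
    then show "nv_add (c0_sum X) x y \<in> nv_carrier (c0_sum X)"
      using xn X.add_closed by (simp add: c0_sum_simps(1,2))
    show "nv_norm (c0_sum X) (nv_add (c0_sum X) x y) \<le> nv_norm (c0_sum X) x + nv_norm (c0_sum X) y"
    proof (rule c0_sum_norm_le)
      fix n
      show "nv_norm (X n) (nv_add (c0_sum X) x y n) \<le> nv_norm (c0_sum X) x + nv_norm (c0_sum X) y"
        using X.norm_triangle[OF xn, of n] c0_sum_block_le[OF x, of n] c0_sum_block_le[OF y, of n]
        by (simp add: c0_sum_simps(2))
    qed
  next
    fix x and c :: 'k assume x: "x \<in> nv_carrier (c0_sum X)"
    then have xn: "x n \<in> nv_carrier (X n)" for n by (simp add: c0_sum_simps)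
    have "(\<lambda>n. norm c * nv_norm (X n) (x n)) \<longlonglongrightarrow> 0"
      using x by (auto simp: c0_sum_simps intro: tendsto_mult_right_zero)
    then show scaled: "nv_scale (c0_sum X) c x \<in> nv_carrier (c0_sum X)"
      using xn by (simp add: c0_sum_simps(1,3) X.scale_closed X.norm_scale)
    have block: "nv_norm (X n) (nv_scale (c0_sum X) c x n) = norm c * nv_norm (X n) (x n)" for n
      using X.norm_scale[OF xn] by (simp add: c0_sum_simps(3))
    show nonneg: "0 \<le> nv_norm (c0_sum X) x"
      using X.norm_nonneg[OF xn] c0_sum_block_le[OF x] by (rule order_trans)
    show "nv_norm (c0_sum X) (nv_scale (c0_sum X) c x) = norm c * nv_norm (c0_sum X) x"
    proof (rule antisym)
      show "nv_norm (c0_sum X) (nv_scale (c0_sum X) c x) \<le> norm c * nv_norm (c0_sum X) x"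
        by (rule c0_sum_norm_le) (simp add: block mult_left_mono c0_sum_block_le[OF x])
      show "norm c * nv_norm (c0_sum X) x \<le> nv_norm (c0_sum X) (nv_scale (c0_sum X) c x)"
      proof (cases "c = 0")
        case True
        then show ?thesis
          using order_trans[OF X.norm_nonneg c0_sum_block_le[OF scaled]] scaled by (simp add: c0_sum_simps(1))
      next
        case False
        have "nv_norm (c0_sum X) x \<le> nv_norm (c0_sum X) (nv_scale (c0_sum X) c x) / norm c"
          using c0_sum_block_le[OF scaled] False
          by (intro c0_sum_norm_le) (simp add: block pos_le_divide_eq mult.commute)
        then show ?thesis using False by (simp add: pos_le_divide_eq mult.commute)
      qed
    qed
  next
    fix x y and c :: 'k assume x: "x \<in> nv_carrier (c0_sum X)" and y: "y \<in> nv_carrier (c0_sum X)"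
    then show "nv_add (c0_sum X) x y = nv_add (c0_sum X) y x"
      using X.add_commute by (auto simp: c0_sum_simps)
    show "nv_scale (c0_sum X) c (nv_add (c0_sum X) x y)
        = nv_add (c0_sum X) (nv_scale (c0_sum X) c x) (nv_scale (c0_sum X) c y)"
      using x y X.scale_add_right by (auto simp: c0_sum_simps)
  qed (auto simp: c0_sum_simps X.add_assoc X.scale_add_left X.scale_scale)
qed

text \<open>\<open>T\<close> acts by \<open>synthesis\<close> in each block. The norm of block
  \<open>n\<close> of \<open>T v\<close> is at most the sum over \<open>l\<close> of
  \<open>norm (v l)\<close> times the norm of block \<open>n\<close> of \<open>y l\<close>, which
  gives both the norm bound and membership in the c0-sum.\<close>

lemma c0_sum_ell2_fin_ex_operator:
  fixes y :: "nat \<Rightarrow> nat \<Rightarrow> nat \<Rightarrow> 'k::{real_normed_field, banach}" and d :: "nat \<Rightarrow> nat"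
  defines "Y \<equiv> c0_sum (\<lambda>n. ell2_fin (d n)) :: ('k, nat \<Rightarrow> nat \<Rightarrow> 'k) nspace"
  assumes y: "\<And>l. y l \<in> nv_carrier Y \<and> nv_norm Y (y l) \<le> 1"
  shows "\<exists>T\<in>nv_carrier (operator_space (ell 1) Y). \<forall>l. T (unit_seq l) = y l"
proof -
  define T where "T v = (\<lambda>n. synthesis (\<lambda>l. y l n) v)" for v
  have n1: "normed_nspace (ell 1 :: ('k, nat \<Rightarrow> 'k) nspace)" by (rule normed_nspace_ell) simp
  have block: "nv_norm (ell2_fin (d n)) (y l n) \<le> 1" for l n
    using y[of l] c0_sum_block_le[of "y l" "\<lambda>n. ell2_fin (d n)" n] by (auto simp: Y_def)
  have zero: "y l n c = 0" if "c \<ge> d n" for l n c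
    using y[of l] that by (auto simp: Y_def c0_sum_simps ell2_fin_simps)
  have y1: "norm (y l n c) \<le> 1" for l n c
  proof (cases "c < d n")
    case True
    then have "norm (y l n c) \<le> nv_norm (ell2_fin (d n)) (y l n)"
      using member_le_L2_set[of "{..<d n}" c "\<lambda>i. norm (y l n i)"] by (simp add: ell2_fin_simps)
    then show ?thesis using block[of n l] by simp
  qed (simp add: zero)
  have nonneg: "0 \<le> nv_norm (ell2_fin (d n)) w" for n and w :: "nat \<Rightarrow> 'k"
    by (simp add: ell2_fin_simps(4) L2_set_nonneg)
  have le: "norm (norm (v l) * nv_norm (ell2_fin (d n)) (y l n)) \<le> norm (v l)" for v :: "nat \<Rightarrow> 'k" and l n
    using mult_left_le[OF block[of n l], of "norm (v l)"]
    by (simp add: ell2_fin_simps(4) L2_set_nonneg abs_mult)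
  have Tn: "nv_norm (ell2_fin (d n)) (T v n) \<le> (\<Sum>l. norm (v l) * nv_norm (ell2_fin (d n)) (y l n))"
    and sm: "summable (\<lambda>l. norm (v l) * nv_norm (ell2_fin (d n)) (y l n))"
    if v: "v \<in> nv_carrier (ell 1)" for v n
  proof -
    let ?E = "ell2_fin (d n) :: ('k, nat \<Rightarrow> 'k) nspace"
    show sm: "summable (\<lambda>l. norm (v l) * nv_norm (ell2_fin (d n)) (y l n))"
    proof (rule summable_comparison_test)
      show "\<exists>N. \<forall>l\<ge>N. norm (norm (v l) * nv_norm ?E (y l n)) \<le> norm (v l)"
        using le by blast
    qed (use v in \<open>simp add: ell_one_carrier\<close>)
    have partial: "nv_norm ?E (\<lambda>c. \<Sum>l<L. v l * y l n c) \<le> (\<Sum>l<L. norm (v l) * nv_norm ?E (y l n))" for L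
    proof (induction L)
      case 0
      then show ?case by (simp add: ell2_fin_simps L2_set_def)
    next
      case (Suc L)
      have "nv_norm ?E (\<lambda>c. \<Sum>l<Suc L. v l * y l n c)
          \<le> nv_norm ?E (\<lambda>c. \<Sum>l<L. v l * y l n c) + norm (v L) * nv_norm ?E (y L n)"
        using normed_nspace.norm_triangle[OF normed_nspace_ell2_fin, of "\<lambda>c. \<Sum>l<L. v l * y l n c" "d n"
            "\<lambda>c. v L * y L n c"] zero
        by (simp add: ell2_fin_simps norm_mult L2_set_right_distrib)
      then show ?case using Suc by simp
    qed
    show "nv_norm ?E (T v n) \<le> (\<Sum>l. norm (v l) * nv_norm ?E (y l n))"
    proof (rule LIMSEQ_le_const2)
      show "(\<lambda>L. nv_norm ?E (\<lambda>c. \<Sum>l<L. v l * y l n c)) \<longlonglongrightarrow> nv_norm ?E (T v n)"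
        unfolding T_def synthesis_def ell2_fin_simps L2_set_def
        by (intro tendsto_sum tendsto_real_sqrt tendsto_power tendsto_norm summable_LIMSEQ
            synthesis_summable y1 v)
      have "(\<Sum>l<L. norm (v l) * nv_norm ?E (y l n)) \<le> (\<Sum>l. norm (v l) * nv_norm ?E (y l n))" for L
        using sm by (intro sum_le_suminf) (auto simp: ell2_fin_simps L2_set_nonneg)
      then show "\<exists>N. \<forall>L\<ge>N. nv_norm ?E (\<lambda>c. \<Sum>l<L. v l * y l n c) \<le> (\<Sum>l. norm (v l) * nv_norm ?E (y l n))"
        using partial order_trans by blast
    qed
  qed
  have carrier: "T v \<in> nv_carrier Y" if v: "v \<in> nv_carrier (ell 1)" for v
  proof -
    have sv: "summable (\<lambda>l. norm (v l))" using v by (simp add: ell_one_carrier)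
    \<comment> \<open>For fixed \<open>l\<close> the terms tend to 0 because \<open>y l\<close> lies
      in the c0-sum, and \<open>norm (v l)\<close> dominates them uniformly in \<open>n\<close>, so
      limit and sum may be exchanged.\<close>
    have "(\<lambda>n. \<Sum>l. norm (v l) * nv_norm (ell2_fin (d n)) (y l n)) \<longlonglongrightarrow> (\<Sum>l::nat. 0)"
    proof (rule conjunct2[OF conjunct2[OF tannerys_theorem[OF _ _ sv]]])
      show "(\<lambda>n. norm (v l) * nv_norm (ell2_fin (d n)) (y l n)) \<longlonglongrightarrow> 0" for l
        using y[of l] by (auto simp: Y_def c0_sum_simps intro: tendsto_mult_right_zero)
      show "\<forall>\<^sub>F (l, n) in at_top \<times>\<^sub>F at_top. norm (norm (v l) * nv_norm (ell2_fin (d n)) (y l n)) \<le> norm (v l)"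
        using le[of v] by (intro always_eventually) simp
    qed simp
    then have lim: "(\<lambda>n. \<Sum>l. norm (v l) * nv_norm (ell2_fin (d n)) (y l n)) \<longlonglongrightarrow> 0" by simp
    have "(\<lambda>n. nv_norm (ell2_fin (d n)) (T v n)) \<longlonglongrightarrow> 0"
      by (rule tendsto_sandwich[OF always_eventually always_eventually tendsto_const lim])
        (use nonneg Tn[OF v] in blast)+
    moreover have "T v n \<in> nv_carrier (ell2_fin (d n))" for n
      by (simp add: ell2_fin_simps(1) T_def synthesis_def zero)
    ultimately show ?thesis by (simp add: Y_def c0_sum_simps(1))
  qed
  have bound: "nv_norm Y (T v) \<le> 1 * nv_norm (ell 1) v" if v: "v \<in> nv_carrier (ell 1)" for v
  proof -
    have sv: "summable (\<lambda>l. norm (v l))" using v by (simp add: ell_one_carrier)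
    have "(\<Sum>l. norm (v l) * nv_norm (ell2_fin (d n)) (y l n)) \<le> (\<Sum>l. norm (v l))" for n
      by (intro suminf_le sm[OF v] sv mult_left_le block) auto
    then show ?thesis
      unfolding Y_def mult_1 ell_one_norm[OF v] by (intro c0_sum_norm_le order_trans[OF Tn[OF v]])
  qed
  have "bounded_operator (ell 1) Y T"
    unfolding bounded_operator_def
  proof (intro conjI ballI allI exI[of _ 1])
    fix v w :: "nat \<Rightarrow> 'k" assume "v \<in> nv_carrier (ell 1)" "w \<in> nv_carrier (ell 1)"
    then show "T (nv_add (ell 1) v w) = nv_add Y (T v) (T w)"
      using y1 by (simp add: Y_def c0_sum_simps(2) ell2_fin_simps(2) ell_simps(2) T_def synthesis_linear fun_eq_iff)
  next
    fix v :: "nat \<Rightarrow> 'k" and c assume "v \<in> nv_carrier (ell 1)"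
    then show "T (nv_scale (ell 1) c v) = nv_scale Y c (T v)"
      using y1 by (simp add: Y_def c0_sum_simps(3) ell2_fin_simps(3) ell_simps(3) T_def synthesis_linear fun_eq_iff)
  qed (use carrier bound in auto)
  then have "restrict T (nv_carrier (ell 1)) \<in> nv_carrier (operator_space (ell 1) Y)"
    by (simp add: in_operator_space bounded_operator_restrict[OF n1])
  then show ?thesis
    by (intro bexI) (auto simp: T_def synthesis_unit_seq unit_seq_ell)
qed

subsection \<open>The ideals\<close>

lemma bounded_operator_add:
  assumes S: "bounded_operator X Y S" and T: "bounded_operator X Y T" and "normed_nspace Y"
  shows "bounded_operator X Y (\<lambda>x. nv_add Y (S x) (T x))"
proof -
  interpret Y: normed_nspace Y by fact
  obtain K where K: "\<And>x. x \<in> nv_carrier X \<Longrightarrow> nv_norm Y (S x) \<le> K * nv_norm X x"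
    using S unfolding bounded_operator_def by blast
  obtain L where L: "\<And>x. x \<in> nv_carrier X \<Longrightarrow> nv_norm Y (T x) \<le> L * nv_norm X x"
    using T unfolding bounded_operator_def by blast
  note S = bounded_operatorD[OF S] and T = bounded_operatorD[OF T]
  show ?thesis
    unfolding bounded_operator_def
  proof (intro conjI ballI allI exI[of _ "K + L"])
    fix x y assume xy: "x \<in> nv_carrier X" "y \<in> nv_carrier X"
    have "nv_add Y (nv_add Y (S x) (S y)) (nv_add Y (T x) (T y))
        = nv_add Y (S x) (nv_add Y (nv_add Y (S y) (T x)) (T y))"
      using xy S(1) T(1) by (simp add: Y.add_assoc Y.add_closed)
    also have "\<dots> = nv_add Y (S x) (nv_add Y (nv_add Y (T x) (S y)) (T y))"
      using xy S(1) T(1) by (simp add: Y.add_commute)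
    also have "\<dots> = nv_add Y (nv_add Y (S x) (T x)) (nv_add Y (S y) (T y))"
      using xy S(1) T(1) by (simp add: Y.add_assoc Y.add_closed)
    finally show "nv_add Y (S (nv_add X x y)) (T (nv_add X x y))
        = nv_add Y (nv_add Y (S x) (T x)) (nv_add Y (S y) (T y))"
      using xy S(2) T(2) by simp
  next
    fix x assume x: "x \<in> nv_carrier X"
    have "nv_norm Y (nv_add Y (S x) (T x)) \<le> nv_norm Y (S x) + nv_norm Y (T x)"
      using x S(1) T(1) by (intro Y.norm_triangle) auto
    then show "nv_norm Y (nv_add Y (S x) (T x)) \<le> (K + L) * nv_norm X x"
      using K[OF x] L[OF x] by (simp add: distrib_right)
  qed (simp_all add: S T Y.add_closed Y.scale_add_right)
qed

lemma bounded_operator_scale: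
  assumes S: "bounded_operator X Y S" and "normed_nspace Y"
  shows "bounded_operator X Y (\<lambda>x. nv_scale Y c (S x))"
proof -
  interpret Y: normed_nspace Y by fact
  obtain K where K: "\<And>x. x \<in> nv_carrier X \<Longrightarrow> nv_norm Y (S x) \<le> K * nv_norm X x"
    using S unfolding bounded_operator_def by blast
  note S = bounded_operatorD[OF S]
  show ?thesis
    unfolding bounded_operator_def
  proof (intro conjI ballI allI exI[of _ "norm c * K"])
    fix x assume x: "x \<in> nv_carrier X"
    show "nv_norm Y (nv_scale Y c (S x)) \<le> norm c * K * nv_norm X x"
      using mult_left_mono[OF K[OF x], of "norm c"] by (simp add: Y.norm_scale S(1)[OF x] mult.assoc)
  qed (simp_all add: S Y.scale_closed Y.scale_add_right Y.scale_scale mult.commute)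
qed

text \<open>Boundedness of \<open>S\<close> makes the supremum in the operator norm a genuine upper
  bound.\<close>

lemma norm_le_operator_norm:
  assumes S: "bounded_operator X Y S" and v: "v \<in> nv_carrier X" "nv_norm X v \<le> 1" and "normed_nspace X"
  shows "nv_norm Y (S v) \<le> nv_norm (operator_space X Y) S"
proof -
  obtain K where K: "1 \<le> K" "\<And>x. x \<in> nv_carrier X \<Longrightarrow> nv_norm Y (S x) \<le> K * nv_norm X x"
    using bounded_operator_bound[OF S assms(4)] by blast
  have "nv_norm Y (S x) \<le> K" if "x \<in> nv_carrier X" "nv_norm X x \<le> 1" for x
    using K(2)[OF that(1)] mult_left_mono[OF that(2), of K] K(1) by linarith
  then have "bdd_above ((\<lambda>x. nv_norm Y (S x)) ` {x \<in> nv_carrier X. nv_norm X x \<le> 1})"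
    by (intro bdd_aboveI2[of _ _ K]) auto
  then show ?thesis
    using v by (auto simp: operator_space_def intro: cSUP_upper)
qed

section \<open>Operators that are small along a set of blocks\<close>

definition large_indices ::
    "('k::real_normed_field, 'v) nspace \<Rightarrow> (nat \<Rightarrow> nat) \<Rightarrow> (nat \<Rightarrow> nat \<Rightarrow> 'w \<Rightarrow> 'k) \<Rightarrow> ('v \<Rightarrow> 'w) \<Rightarrow>
      real \<Rightarrow> nat \<Rightarrow> nat set" where
  "large_indices X N x R \<epsilon> n =
     {j. j < N n \<and> (\<exists>v\<in>nv_carrier X. nv_norm X v \<le> 1 \<and> \<epsilon> \<le> norm (x n j (R v)))}"

text \<open>One \<open>\<epsilon>\<close> serves both as threshold for the values and as proportion
  of the indices; by monotonicity in the threshold this is equivalent to using two.\<close>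

definition negligible ::
    "('k::real_normed_field, 'v) nspace \<Rightarrow> (nat \<Rightarrow> nat) \<Rightarrow> (nat \<Rightarrow> nat \<Rightarrow> 'w \<Rightarrow> 'k) \<Rightarrow> nat set \<Rightarrow>
      ('v \<Rightarrow> 'w) \<Rightarrow> bool" where
  "negligible X N x A R \<longleftrightarrow>
     (\<forall>\<epsilon>>0. \<exists>n0. \<forall>n\<ge>n0. n \<in> A \<longrightarrow> real (card (large_indices X N x R \<epsilon> n)) \<le> \<epsilon> * real (N n))"

lemma finite_large_indices [simp]: "finite (large_indices X N x R \<epsilon> n)"
  by (rule finite_subset[of _ "{..<N n}"]) (auto simp: large_indices_def)

text \<open>The common tool for scaling, norm limits and composition. The comparison operator
  \<open>S\<close> may depend on \<open>\<epsilon>\<close>, as limits require;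
  \<open>\<delta> \<le> \<epsilon>\<close> is asked for because \<open>\<delta>\<close> also bounds
  the proportion.\<close>

lemma negligible_mono:
  assumes "\<And>\<epsilon>. 0 < \<epsilon> \<Longrightarrow> \<exists>\<delta> S. 0 < \<delta> \<and> \<delta> \<le> \<epsilon> \<and> negligible X N x A S \<and>
      (\<forall>n. large_indices Z N x R \<epsilon> n \<subseteq> large_indices X N x S \<delta> n)"
  shows "negligible Z N x A R"
  unfolding negligible_def
proof (intro allI impI)
  fix \<epsilon> :: real assume "0 < \<epsilon>"
  then obtain \<delta> S where \<delta>: "0 < \<delta>" "\<delta> \<le> \<epsilon>" "negligible X N x A S"
      "\<And>n. large_indices Z N x R \<epsilon> n \<subseteq> large_indices X N x S \<delta> n"
    using assms by metis
  then obtain n0 where n0: "\<And>n. n0 \<le> n \<Longrightarrow> n \<in> A \<Longrightarrow> real (card (large_indices X N x S \<delta> n)) \<le> \<delta> * real (N n)"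
    unfolding negligible_def by metis
  have "real (card (large_indices Z N x R \<epsilon> n)) \<le> \<epsilon> * real (N n)" if "n0 \<le> n" "n \<in> A" for n
  proof -
    have "card (large_indices Z N x R \<epsilon> n) \<le> card (large_indices X N x S \<delta> n)"
      by (intro card_mono \<delta>) simp
    moreover have "\<delta> * real (N n) \<le> \<epsilon> * real (N n)" using \<delta> by (intro mult_right_mono) auto
    ultimately show ?thesis using n0[OF that] by linarith
  qed
  then show "\<exists>n0. \<forall>n\<ge>n0. n \<in> A \<longrightarrow> real (card (large_indices Z N x R \<epsilon> n)) \<le> \<epsilon> * real (N n)" by blast
qed

text \<open>A sum of norm at least \<open>\<epsilon>\<close> has a term of norm at least
  \<open>\<epsilon> / 2\<close>, and each of the two exceptional sets has proportion at most
  \<open>\<epsilon> / 2\<close>.\<close>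

lemma negligible_add:
  assumes S: "negligible X N x A S" and T: "negligible X N x A T"
    and R: "\<And>n j v. j < N n \<Longrightarrow> v \<in> nv_carrier X \<Longrightarrow> x n j (R v) = x n j (S v) + x n j (T v)"
  shows "negligible X N x A R"
  unfolding negligible_def
proof (intro allI impI)
  fix \<epsilon> :: real assume "0 < \<epsilon>"
  then have \<epsilon>: "0 < \<epsilon> / 2" by simp
  obtain n0 where n0: "\<And>n. n0 \<le> n \<Longrightarrow> n \<in> A \<Longrightarrow> real (card (large_indices X N x S (\<epsilon> / 2) n)) \<le> \<epsilon> / 2 * real (N n)"
    using S \<epsilon> unfolding negligible_def by metis
  obtain n1 where n1: "\<And>n. n1 \<le> n \<Longrightarrow> n \<in> A \<Longrightarrow> real (card (large_indices X N x T (\<epsilon> / 2) n)) \<le> \<epsilon> / 2 * real (N n)"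
    using T \<epsilon> unfolding negligible_def by metis
  have "real (card (large_indices X N x R \<epsilon> n)) \<le> \<epsilon> * real (N n)" if n: "max n0 n1 \<le> n" "n \<in> A" for n
  proof -
    have "large_indices X N x R \<epsilon> n \<subseteq> large_indices X N x S (\<epsilon> / 2) n \<union> large_indices X N x T (\<epsilon> / 2) n"
    proof
      fix j assume "j \<in> large_indices X N x R \<epsilon> n"
      then obtain v where j: "j < N n" and v: "v \<in> nv_carrier X" "nv_norm X v \<le> 1" "\<epsilon> \<le> norm (x n j (R v))"
        unfolding large_indices_def by blast
      have "\<epsilon> \<le> norm (x n j (S v)) + norm (x n j (T v))"
        using v(3) norm_triangle_ineq[of "x n j (S v)" "x n j (T v)"] R[OF j v(1)] by simp
      then have "\<epsilon> / 2 \<le> norm (x n j (S v)) \<or> \<epsilon> / 2 \<le> norm (x n j (T v))" by linarith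
      then show "j \<in> large_indices X N x S (\<epsilon> / 2) n \<union> large_indices X N x T (\<epsilon> / 2) n"
        using j v(1,2) unfolding large_indices_def by blast
    qed
    then have "card (large_indices X N x R \<epsilon> n)
        \<le> card (large_indices X N x S (\<epsilon> / 2) n \<union> large_indices X N x T (\<epsilon> / 2) n)"
      by (intro card_mono) auto
    also have "\<dots> \<le> card (large_indices X N x S (\<epsilon> / 2) n) + card (large_indices X N x T (\<epsilon> / 2) n)"
      by (rule card_Un_le)
    finally show ?thesis using n0[of n] n1[of n] n by simp
  qed
  then show "\<exists>n0. \<forall>n\<ge>n0. n \<in> A \<longrightarrow> real (card (large_indices X N x R \<epsilon> n)) \<le> \<epsilon> * real (N n)" by blast
qed

text \<open>The quantifier over \<open>U\<close> builds in invariance under operators on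
  \<open>Y\<close>. A family \<open>\<A>\<close> stands for the intersection of the ideals of its
  members; such families will encode sets of reals.\<close>

definition vanishing_ideal ::
    "('k::real_normed_field, 'v) nspace \<Rightarrow> ('k, 'w) nspace \<Rightarrow> (nat \<Rightarrow> nat) \<Rightarrow> (nat \<Rightarrow> nat \<Rightarrow> 'w \<Rightarrow> 'k) \<Rightarrow>
      nat set set \<Rightarrow> ('v \<Rightarrow> 'w) set" where
  "vanishing_ideal X Y N x \<A> =
     {S \<in> nv_carrier (operator_space X Y).
        \<forall>A\<in>\<A>. \<forall>U. bounded_operator Y Y U \<longrightarrow> negligible X N x A (\<lambda>v. U (S v))}"

text \<open>Left multiplication is absorbed into \<open>U\<close>, right multiplication only
  rescales the unit ball, and an approximation in operator norm is uniform over all functionals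
  \<open>x n j\<close>, since these have norm at most 1.\<close>

lemma vanishing_ideal_closed:
  fixes X :: "('k::real_normed_field, 'v) nspace" and Y :: "('k, 'w) nspace"
  assumes X: "normed_nspace X" and Y: "normed_nspace Y"
    and x: "\<And>n j. j < N n \<Longrightarrow> bounded_functional Y 1 (x n j)"
  shows "vanishing_ideal X Y N x \<A> \<in> closed_ideals X Y"
proof -
  interpret X: normed_nspace X by fact
  interpret Y: normed_nspace Y by fact
  let ?J = "vanishing_ideal X Y N x \<A>"
  let ?O = "operator_space X Y"
  have J: "S \<in> ?J \<longleftrightarrow> S \<in> extensional (nv_carrier X) \<and> bounded_operator X Y S \<and>
      (\<forall>A\<in>\<A>. \<forall>U. bounded_operator Y Y U \<longrightarrow> negligible X N x A (\<lambda>v. U (S v)))" for S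
    by (simp add: vanishing_ideal_def in_operator_space)
  have Oadd: "nv_add ?O S T = restrict (\<lambda>v. nv_add Y (S v) (T v)) (nv_carrier X)"
    and Oscale: "nv_scale ?O c S = restrict (\<lambda>v. nv_scale Y c (S v)) (nv_carrier X)" for S T c
    by (simp_all add: operator_space_def)
  have scale_mem: "nv_scale ?O c S \<in> ?J" if S: "S \<in> ?J" for S c
    unfolding J Oscale
  proof (intro conjI ballI allI impI)
    show "bounded_operator X Y (restrict (\<lambda>v. nv_scale Y c (S v)) (nv_carrier X))"
      using S by (simp add: J bounded_operator_restrict[OF X] bounded_operator_scale[OF _ Y])
    fix A U assume A: "A \<in> \<A>" and U: "bounded_operator Y Y U"
    have Sn: "negligible X N x A (\<lambda>v. U (S v))" and Sb: "bounded_operator X Y S"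
      using S A U by (auto simp: J)
    show "negligible X N x A (\<lambda>v. U (restrict (\<lambda>v. nv_scale Y c (S v)) (nv_carrier X) v))"
    proof (rule negligible_mono)
      fix \<epsilon> :: real assume \<epsilon>: "0 < \<epsilon>"
      \<comment> \<open>Adding 1 to \<open>norm c\<close> covers \<open>c = 0\<close> and keeps the
        new threshold at most \<open>\<epsilon>\<close>.\<close>
      let ?\<delta> = "\<epsilon> / (1 + norm c)"
      have "large_indices X N x (\<lambda>v. U (restrict (\<lambda>v. nv_scale Y c (S v)) (nv_carrier X) v)) \<epsilon> n
          \<subseteq> large_indices X N x (\<lambda>v. U (S v)) ?\<delta> n" for n
      proof
        fix j assume "j \<in> large_indices X N x (\<lambda>v. U (restrict (\<lambda>v. nv_scale Y c (S v)) (nv_carrier X) v)) \<epsilon> n"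
        then obtain v where j: "j < N n" and v: "v \<in> nv_carrier X" "nv_norm X v \<le> 1"
            "\<epsilon> \<le> norm (x n j (U (nv_scale Y c (S v))))"
          unfolding large_indices_def by auto
        have "x n j (U (nv_scale Y c (S v))) = c * x n j (U (S v))"
          using bounded_operatorD[OF U] bounded_operatorD(1)[OF Sb v(1)] bounded_functionalD(2)[OF x[OF j]]
          by simp
        then have "\<epsilon> \<le> (1 + norm c) * norm (x n j (U (S v)))"
          using v(3) by (simp add: norm_mult distrib_right)
             (metis add.commute add_increasing2 norm_ge_zero)
        then have "?\<delta> \<le> norm (x n j (U (S v)))"
          by (simp add: divide_le_eq add_pos_nonneg mult.commute)
        then show "j \<in> large_indices X N x (\<lambda>v. U (S v)) ?\<delta> n"
          using j v unfolding large_indices_def by blast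
      qed
      moreover have "0 < ?\<delta>" "?\<delta> \<le> \<epsilon>"
        using \<epsilon> by (auto simp: add_pos_nonneg divide_le_eq)
      ultimately show "\<exists>\<delta> T. 0 < \<delta> \<and> \<delta> \<le> \<epsilon> \<and> negligible X N x A T \<and>
          (\<forall>n. large_indices X N x (\<lambda>v. U (restrict (\<lambda>v. nv_scale Y c (S v)) (nv_carrier X) v)) \<epsilon> n
            \<subseteq> large_indices X N x T \<delta> n)"
        using Sn by blast
    qed
  qed auto
  have add_mem: "nv_add ?O S T \<in> ?J" if S: "S \<in> ?J" and T: "T \<in> ?J" for S T
    unfolding J Oadd
  proof (intro conjI ballI allI impI)
    show "bounded_operator X Y (restrict (\<lambda>v. nv_add Y (S v) (T v)) (nv_carrier X))"
      using S T by (simp add: J bounded_operator_restrict[OF X] bounded_operator_add[OF _ _ Y])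
    fix A U assume A: "A \<in> \<A>" and U: "bounded_operator Y Y U"
    show "negligible X N x A (\<lambda>v. U (restrict (\<lambda>v. nv_add Y (S v) (T v)) (nv_carrier X) v))"
    proof (rule negligible_add)
      show "negligible X N x A (\<lambda>v. U (S v))" "negligible X N x A (\<lambda>v. U (T v))"
        using S T A U by (auto simp: J)
      fix n j v assume j: "j < N n" and v: "v \<in> nv_carrier X"
      have "S v \<in> nv_carrier Y" "T v \<in> nv_carrier Y" using S T v by (auto simp: J dest: bounded_operatorD(1))
      then show "x n j (U (restrict (\<lambda>v. nv_add Y (S v) (T v)) (nv_carrier X) v)) = x n j (U (S v)) + x n j (U (T v))"
        using v bounded_operatorD[OF U] bounded_functionalD(1)[OF x[OF j]] by simp
    qed
  qed auto
  have "?J \<noteq> {}"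
  proof -
    obtain y0 where y0: "y0 \<in> nv_carrier Y" using Y.carrier_nonempty by blast
    \<comment> \<open>The zero vector of \<open>Y\<close>, obtained by scaling an arbitrary
      element.\<close>
    define z where "z = nv_scale Y 0 y0"
    have z: "z \<in> nv_carrier Y" "nv_add Y z z = z" "nv_scale Y c z = z" "nv_norm Y z = 0" for c
      using y0 Y.scale_closed Y.scale_add_left[of y0 0 0] Y.scale_scale[OF y0] Y.norm_scale[OF y0]
      by (simp_all add: z_def)
    have "restrict (\<lambda>_. z) (nv_carrier X) \<in> ?J"
      unfolding J
    proof (intro conjI ballI allI impI)
      have "bounded_operator X Y (\<lambda>_. z)"
        using z by (auto simp: bounded_operator_def intro!: exI[of _ 0])
      then show "bounded_operator X Y (restrict (\<lambda>_. z) (nv_carrier X))"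
        by (simp add: bounded_operator_restrict[OF X])
      fix A U assume U: "bounded_operator Y Y U"
      have xz: "x n j (U z) = 0" if "j < N n" for n j
      proof -
        have "U z = nv_scale Y 0 (U y0)" using bounded_operatorD(3)[OF U y0] by (simp add: z_def)
        then show ?thesis
          using bounded_functionalD(2)[OF x[OF that] bounded_operatorD(1)[OF U y0]] by simp
      qed
      have "large_indices X N x (\<lambda>v. U (restrict (\<lambda>_. z) (nv_carrier X) v)) \<epsilon> n = {}" if "0 < \<epsilon>" for \<epsilon> n
        using that xz by (auto simp: large_indices_def)
      then show "negligible X N x A (\<lambda>v. U (restrict (\<lambda>_. z) (nv_carrier X) v))"
        by (simp add: negligible_def)
    qed auto
    then show ?thesis by blast
  qed
  with add_mem scale_mem have sub: "linear_subspace ?O ?J"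
    by (auto simp: linear_subspace_def vanishing_ideal_def)
  have closed: "norm_closed ?O ?J"
    unfolding norm_closed_def
  proof (intro allI impI, elim conjE)
    fix u T assume u: "\<forall>n::nat. u n \<in> ?J" and T: "T \<in> nv_carrier ?O"
      and lim: "(\<lambda>n. nv_dist ?O (u n) T) \<longlonglongrightarrow> 0"
    have Tb: "bounded_operator X Y T" and Te: "T \<in> extensional (nv_carrier X)"
      using T by (auto simp: in_operator_space)
    have ub: "bounded_operator X Y (u n)" for n using u by (simp add: J)
    have dist: "nv_norm Y (nv_add Y (u n v) (nv_scale Y (- 1) (T v))) \<le> nv_dist ?O (u n) T"
      if v: "v \<in> nv_carrier X" "nv_norm X v \<le> 1" for n v
    proof -
      have "bounded_operator X Y (nv_add ?O (u n) (nv_scale ?O (- 1) T))"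
        unfolding Oadd Oscale bounded_operator_restrict[OF X]
        by (intro bounded_operator_add ub Y bounded_operator_restrict[OF X, THEN iffD2] bounded_operator_scale Tb)
      from norm_le_operator_norm[OF this v X] show ?thesis
        using v by (simp add: nv_dist_def Oadd Oscale)
    qed
    show "T \<in> ?J"
      unfolding J
    proof (intro conjI ballI allI impI)
      fix A U assume A: "A \<in> \<A>" and U: "bounded_operator Y Y U"
      obtain K where K: "1 \<le> K" "\<And>y. y \<in> nv_carrier Y \<Longrightarrow> nv_norm Y (U y) \<le> K * nv_norm Y y"
        using bounded_operator_bound[OF U Y] by blast
      show "negligible X N x A (\<lambda>v. U (T v))"
      proof (rule negligible_mono)
        fix \<epsilon> :: real assume \<epsilon>: "0 < \<epsilon>"
        then have "\<forall>\<^sub>F n in sequentially. nv_dist ?O (u n) T < \<epsilon> / (2 * K)"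
          using K by (intro order_tendstoD(2)[OF lim]) auto
        \<comment> \<open>The index \<open>m\<close> is fixed before the blocks: on the unit ball,
          \<open>U (u m v)\<close> and \<open>U (T v)\<close> then differ by at most
          \<open>\<epsilon> / 2\<close> under every functional.\<close>
        then obtain m where m: "nv_dist ?O (u m) T < \<epsilon> / (2 * K)"
          unfolding eventually_sequentially by blast
        have "large_indices X N x (\<lambda>v. U (T v)) \<epsilon> n \<subseteq> large_indices X N x (\<lambda>v. U (u m v)) (\<epsilon> / 2) n" for n
        proof
          fix j assume "j \<in> large_indices X N x (\<lambda>v. U (T v)) \<epsilon> n"
          then obtain v where j: "j < N n" and v: "v \<in> nv_carrier X" "nv_norm X v \<le> 1"
              "\<epsilon> \<le> norm (x n j (U (T v)))"
            unfolding large_indices_def by blast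
          let ?w = "nv_add Y (u m v) (nv_scale Y (- 1) (T v))"
          have c: "u m v \<in> nv_carrier Y" "T v \<in> nv_carrier Y"
            using ub Tb v(1) by (auto dest: bounded_operatorD(1))
          then have w: "?w \<in> nv_carrier Y" by (intro Y.add_closed Y.scale_closed)
          have "norm (x n j (U ?w)) = norm (x n j (U (u m v)) - x n j (U (T v)))"
            using c bounded_operatorD[OF U] bounded_functionalD(1,2)[OF x[OF j]] Y.scale_closed by simp
          moreover have "norm (x n j (U ?w)) \<le> K * nv_dist ?O (u m) T"
          proof -
            have "norm (x n j (U ?w)) \<le> nv_norm Y (U ?w)"
              using bounded_functionalD(3)[OF x[OF j] bounded_operatorD(1)[OF U w]] by simp
            also have "\<dots> \<le> K * nv_norm Y ?w" by (rule K(2)[OF w])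
            also have "\<dots> \<le> K * nv_dist ?O (u m) T" using K(1) dist[OF v(1,2)] by (intro mult_left_mono) auto
            finally show ?thesis .
          qed
          moreover have "K * nv_dist ?O (u m) T \<le> \<epsilon> / 2"
            using m K(1) by (simp add: field_simps)
          ultimately have "\<epsilon> / 2 \<le> norm (x n j (U (u m v)))"
            using v(3) norm_triangle_ineq2[of "x n j (U (T v))" "x n j (U (u m v))"]
              norm_minus_commute[of "x n j (U (T v))" "x n j (U (u m v))"] by linarith
          then show "j \<in> large_indices X N x (\<lambda>v. U (u m v)) (\<epsilon> / 2) n"
            using j v unfolding large_indices_def by blast
        qed
        moreover have "negligible X N x A (\<lambda>v. U (u m v))" using u A U by (simp add: J)
        ultimately show "\<exists>\<delta> S. 0 < \<delta> \<and> \<delta> \<le> \<epsilon> \<and> negligible X N x A S \<and>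
            (\<forall>n. large_indices X N x (\<lambda>v. U (T v)) \<epsilon> n \<subseteq> large_indices X N x S \<delta> n)"
          using \<epsilon> by (intro exI[of _ "\<epsilon> / 2"] exI[of _ "\<lambda>v. U (u m v)"]) auto
      qed
    qed (use Tb Te in auto)
  qed
  have ideal: "compose (nv_carrier X) P (compose (nv_carrier X) S Q) \<in> ?J"
    if S: "S \<in> ?J" and P: "P \<in> nv_carrier (operator_space Y Y)" and Q: "Q \<in> nv_carrier (operator_space X X)"
    for S P Q
    unfolding J
  proof (intro conjI ballI allI impI)
    have Pb: "bounded_operator Y Y P" and Qb: "bounded_operator X X Q" and Sb: "bounded_operator X Y S"
      using S P Q by (auto simp: in_operator_space J)
    have eq: "compose (nv_carrier X) P (compose (nv_carrier X) S Q) = restrict (\<lambda>v. P (S (Q v))) (nv_carrier X)"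
      by (auto simp: compose_def restrict_def)
    show "bounded_operator X Y (compose (nv_carrier X) P (compose (nv_carrier X) S Q))"
      unfolding eq bounded_operator_restrict[OF X]
      by (intro bounded_operator_compose[OF bounded_operator_compose[OF Qb Sb X] Pb Y])
    fix A U assume A: "A \<in> \<A>" and U: "bounded_operator Y Y U"
    \<comment> \<open>\<open>U\<close> followed after \<open>P\<close> is again an operator on
      \<open>Y\<close>, hence admissible in the definition of the ideal.\<close>
    have UP: "bounded_operator Y Y (\<lambda>y. U (P y))" by (rule bounded_operator_compose[OF Pb U Y])
    have neg: "negligible X N x A (\<lambda>v. U (P (S v)))" using S A UP by (auto simp: J)
    obtain K where K: "1 \<le> K" "\<And>v. v \<in> nv_carrier X \<Longrightarrow> nv_norm X (Q v) \<le> K * nv_norm X v"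
      using bounded_operator_bound[OF Qb X] by blast
    show "negligible X N x A (\<lambda>v. U (compose (nv_carrier X) P (compose (nv_carrier X) S Q) v))"
      unfolding eq
    proof (rule negligible_mono)
      fix \<epsilon> :: real assume \<epsilon>: "0 < \<epsilon>"
      have "large_indices X N x (\<lambda>v. U (restrict (\<lambda>v. P (S (Q v))) (nv_carrier X) v)) \<epsilon> n
          \<subseteq> large_indices X N x (\<lambda>v. U (P (S v))) (\<epsilon> / K) n" for n
      proof
        fix j assume "j \<in> large_indices X N x (\<lambda>v. U (restrict (\<lambda>v. P (S (Q v))) (nv_carrier X) v)) \<epsilon> n"
        then obtain v where j: "j < N n" and v: "v \<in> nv_carrier X" "nv_norm X v \<le> 1"
            "\<epsilon> \<le> norm (x n j (U (P (S (Q v)))))"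
          unfolding large_indices_def by auto
        \<comment> \<open>\<open>Q\<close> maps the unit ball into the ball of radius
          \<open>K\<close>; dividing by \<open>K\<close> returns to the unit ball at the cost of a
          factor \<open>K\<close> in the threshold.\<close>
        let ?w = "nv_scale X (of_real (1 / K)) (Q v)"
        have Qv: "Q v \<in> nv_carrier X" by (rule bounded_operatorD(1)[OF Qb v(1)])
        then have w: "?w \<in> nv_carrier X" by (rule X.scale_closed)
        have nQv: "nv_norm X (Q v) \<le> K"
          using K(2)[OF v(1)] mult_left_mono[OF v(2), of K] K(1) by linarith
        have nw: "nv_norm X ?w \<le> 1"
          using K(1) nQv by (simp add: X.norm_scale[OF Qv] norm_divide)
        have "x n j (U (P (S ?w))) = of_real (1 / K) * x n j (U (P (S (Q v))))"
          using Qv bounded_operatorD[OF Sb] bounded_operatorD[OF UP] bounded_functionalD(2)[OF x[OF j]] by simp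
        then have "norm (x n j (U (P (S ?w)))) = norm (x n j (U (P (S (Q v))))) / K"
          using K(1) by (simp add: norm_mult norm_divide)
        then have "\<epsilon> / K \<le> norm (x n j (U (P (S ?w))))"
          using v(3) K(1) by (simp add: divide_right_mono)
        then show "j \<in> large_indices X N x (\<lambda>v. U (P (S v))) (\<epsilon> / K) n"
          using j w nw unfolding large_indices_def by blast
      qed
      moreover have "0 < \<epsilon> / K" "\<epsilon> / K \<le> \<epsilon>" using \<epsilon> K(1) by (auto simp: divide_le_eq)
      ultimately show "\<exists>\<delta> R. 0 < \<delta> \<and> \<delta> \<le> \<epsilon> \<and> negligible X N x A R \<and>
          (\<forall>n. large_indices X N x (\<lambda>v. U (restrict (\<lambda>v. P (S (Q v))) (nv_carrier X) v)) \<epsilon> n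
            \<subseteq> large_indices X N x R \<delta> n)"
        using neg by blast
    qed
  qed (simp add: compose_def)
  show ?thesis
    using sub closed ideal by (simp add: closed_ideals_def)
qed

section \<open>Spaces with block coordinates\<close>

text \<open>What the two target spaces share. Block \<open>n\<close> has \<open>d n\<close>
  coordinates, read off by \<open>coord\<close> and assembled by \<open>comb\<close>. The norm
  dominates the \<open>p\<close>-norm inside each single block, while a combination over finitely
  many blocks is dominated by the \<open>p\<close>-norm of all its coefficients; a c0-sum of
  Euclidean spaces satisfies both with \<open>p = 2\<close>. The last axiom makes sequences in the
  unit ball images of the unit vectors.\<close>

locale coordinate_space = normed_nspace Y
  for Y :: "('k::{real_normed_field, banach}, 'w) nspace" +
  fixes p p' :: real and d :: "nat \<Rightarrow> nat"
    and coord :: "nat \<Rightarrow> nat \<Rightarrow> 'w \<Rightarrow> 'k"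
    and comb :: "(nat \<times> nat) set \<Rightarrow> (nat \<times> nat \<Rightarrow> 'k) \<Rightarrow> 'w"
  assumes p: "1 < p" "1 < p'" "1 / p + 1 / p' = 1"
    and coord_functional: "c < d n \<Longrightarrow> bounded_functional Y 1 (coord n c)"
    and coord_sum_le: "u \<in> nv_carrier Y \<Longrightarrow> (\<Sum>c<d n. norm (coord n c u) powr p) \<le> nv_norm Y u powr p"
    and comb_carrier: "finite F \<Longrightarrow> F \<subseteq> (SIGMA n:UNIV. {..<d n}) \<Longrightarrow> comb F a \<in> nv_carrier Y"
    and comb_norm: "finite F \<Longrightarrow> F \<subseteq> (SIGMA n:UNIV. {..<d n}) \<Longrightarrow>
      nv_norm Y (comb F a) powr p \<le> (\<Sum>z\<in>F. norm (a z) powr p)"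
    and comb_empty: "nv_scale Y 0 (comb {} a) = comb {} a"
    and comb_insert: "finite F \<Longrightarrow> z \<notin> F \<Longrightarrow> insert z F \<subseteq> (SIGMA n:UNIV. {..<d n}) \<Longrightarrow>
      comb (insert z F) a = nv_add Y (nv_scale Y (a z) (comb {z} (\<lambda>_. 1))) (comb F a)"
    and coord_comb: "finite F \<Longrightarrow> F \<subseteq> (SIGMA n:UNIV. {..<d n}) \<Longrightarrow> c < d n \<Longrightarrow> (n, c) \<in> F \<Longrightarrow>
      coord n c (comb F a) = a (n, c)"
    and ex_operator: "(\<And>l. y l \<in> nv_carrier Y \<and> nv_norm Y (y l) \<le> 1) \<Longrightarrow>
      \<exists>T\<in>nv_carrier (operator_space (ell 1) Y). \<forall>l. T (unit_seq l) = y l"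
begin

lemma functional_comb:
  assumes f: "bounded_functional Y K f" and F: "finite F" "F \<subseteq> (SIGMA n:UNIV. {..<d n})"
  shows "f (comb F a) = (\<Sum>z\<in>F. a z * f (comb {z} (\<lambda>_. 1)))"
  using F
proof (induction F rule: finite_induct)
  case empty
  then show ?case
    using bounded_functionalD(2)[OF f comb_carrier[of "{}" a], of 0] comb_empty[of a] by simp
next
  case (insert z F)
  have c: "comb {z} (\<lambda>_. 1) \<in> nv_carrier Y" "comb F a \<in> nv_carrier Y"
    using insert by (auto intro!: comb_carrier)
  then show ?case
    using insert bounded_functionalD(1,2)[OF f] scale_closed
    by (simp add: comb_insert[OF insert.hyps insert.prems, of a])
qed

text \<open>Testing \<open>f\<close> on the extremal vector of Hoelder's inequality turns the upper
  \<open>p\<close>-estimate \<open>comb_norm\<close> into an upper \<open>p'\<close>-estimate for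
  functionals.\<close>

lemma dual_norm_le:
  assumes f: "bounded_functional Y K f" and K: "0 < K"
    and F: "finite F" "F \<subseteq> (SIGMA n:UNIV. {..<d n})"
  shows "(\<Sum>z\<in>F. norm (f (comb {z} (\<lambda>_. 1))) powr p') \<le> K powr p'"
proof -
  define \<phi> where "\<phi> z = f (comb {z} (\<lambda>_. 1))" for z
  \<comment> \<open>The extremal coefficients; where \<open>\<phi> z = 0\<close>, division by zero
    yields the coefficient 0, as wanted.\<close>
  define a where "a z = of_real (norm (\<phi> z) powr p') / \<phi> z" for z
  define s where "s = (\<Sum>z\<in>F. norm (\<phi> z) powr p')"
  have s0: "0 \<le> s" by (auto simp: s_def intro: sum_nonneg)
  have pp': "(p' - 1) * p = p'"
  proof -
    have "p' * p * (1 / p + 1 / p') = p' * p" using p by simp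
    then show ?thesis using p by (simp add: field_simps)
  qed
  have an: "norm (a z) = norm (\<phi> z) powr (p' - 1)" for z
    by (cases "\<phi> z = 0") (simp_all add: a_def norm_divide powr_diff)
  have az: "a z * \<phi> z = of_real (norm (\<phi> z) powr p')" for z
    using p by (cases "\<phi> z = 0") (simp_all add: a_def)
  have "nv_norm Y (comb F a) powr p \<le> s"
    using comb_norm[OF F, of a] by (simp add: an powr_powr pp' s_def)
  then have "(nv_norm Y (comb F a) powr p) powr (1 / p) \<le> s powr (1 / p)"
    using p by (intro powr_mono2) auto
  then have na: "nv_norm Y (comb F a) \<le> s powr (1 / p)"
    using p norm_nonneg[OF comb_carrier[OF F]] by (simp add: powr_powr)
  have "f (comb F a) = of_real s"
    using functional_comb[OF f F] az by (simp add: \<phi>_def[symmetric] s_def)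
  then have "s \<le> K * nv_norm Y (comb F a)"
    using bounded_functionalD(3)[OF f comb_carrier[OF F], of a] s0 by simp
  also have "\<dots> \<le> K * s powr (1 / p)" using K na by (intro mult_left_mono) auto
  finally have s: "s \<le> K * s powr (1 / p)" .
  \<comment> \<open>For positive \<open>s\<close>, division of the last estimate by
    \<open>s powr (1 / p)\<close> leaves \<open>s powr (1 / p') \<le> K\<close>.\<close>
  have "s \<le> K powr p'"
  proof (cases "s = 0")
    case False
    then have "s powr (1 / p) > 0" using s0 by simp
    have "s powr (1 / p') = s / s powr (1 / p)"
    proof -
      have "1 / p' = 1 - 1 / p" using p(3) by simp
      then show ?thesis using s0 False by (simp add: powr_diff)
    qed
    also have "\<dots> \<le> K" using s \<open>s powr (1 / p) > 0\<close> by (simp add: divide_le_eq)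
    finally have "(s powr (1 / p')) powr p' \<le> K powr p'" using p by (intro powr_mono2) auto
    then show ?thesis using p s0 by (simp add: powr_powr)
  qed simp
  then show ?thesis by (simp add: s_def \<phi>_def)
qed

end

text \<open>By \<open>k_self\<close> and \<open>k_later\<close>, the sets are so large that overlaps among as many of them as the
  counting in block \<open>n\<close> involves can be neglected, both in block \<open>n\<close> and in later blocks; \<open>N_large\<close>
  makes the resulting number of exceptional functionals a vanishing proportion of \<open>N n\<close>.\<close>

locale sparse_scheme = coordinate_space Y p p' d coord comb
  for Y :: "('k::{real_normed_field, banach}, 'w) nspace" and p p' d coord comb +
  fixes k N :: "nat \<Rightarrow> nat" and G :: "nat \<Rightarrow> nat \<Rightarrow> nat set" and e r :: nat
  assumes G: "i < N n \<Longrightarrow> G n i \<subseteq> {..<d n}" "i < N n \<Longrightarrow> card (G n i) = k n"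
    and k_pos: "0 < k n" and N_pos: "0 < N n"
    and meet: "i < N n \<Longrightarrow> j < N n \<Longrightarrow> i \<noteq> j \<Longrightarrow> card (G n i \<inter> G n j) \<le> r"
    and e: "p \<le> real e" "p' \<le> real e"
    and k_self: "(r * (n ^ e + 1) * n) ^ e \<le> k n"
    and k_later: "n < m \<Longrightarrow> (r * ((n * d n) ^ e + 1) * (n * d n)) ^ e \<le> k m"
    and N_large: "((\<Sum>m<n. N m) + d n * (n * d n) ^ e) * n ^ e * n \<le> N n"
begin

section \<open>Block averages, block vectors and how many of them are large\<close>

text \<open>Normalised with the dual exponent, so that the norm is at most 1, as
  \<open>block_vector\<close> is with the exponent \<open>p\<close>. The two factors multiply to
  \<open>1 / k n\<close>, which makes their pairing over the same set equal to 1.\<close>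

definition block_average :: "nat \<Rightarrow> nat \<Rightarrow> 'w \<Rightarrow> 'k" where
  "block_average n j y = of_real (real (k n) powr - (1 / p')) * (\<Sum>c\<in>G n j. coord n c y)"

definition block_vector :: "nat \<Rightarrow> nat \<Rightarrow> 'w" where
  "block_vector n i = comb ({n} \<times> G n i) (\<lambda>_. of_real (real (k n) powr - (1 / p)))"

lemma finite_G: "i < N n \<Longrightarrow> finite (G n i)"
  using G(1) finite_subset by blast

lemma block_subset: "i < N n \<Longrightarrow> finite ({n} \<times> G n i) \<and> {n} \<times> G n i \<subseteq> (SIGMA n:UNIV. {..<d n})"
  using finite_G G(1) by fastforce

text \<open>\<open>power_mean\<close> over the \<open>k n\<close> points of \<open>G n j\<close>
  bounds the sum of the coordinates by \<open>k n powr (1 / p')\<close> times the norm, because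
  \<open>(p - 1) / p = 1 / p'\<close>.\<close>

lemma block_average_functional:
  assumes j: "j < N n"
  shows "bounded_functional Y 1 (block_average n j)"
  unfolding bounded_functional_def
proof (intro conjI ballI allI)
  have c: "bounded_functional Y 1 (coord n c)" if "c \<in> G n j" for c
    using that G(1)[OF j] by (intro coord_functional) auto
  fix y assume y: "y \<in> nv_carrier Y"
  show "block_average n j (nv_add Y y z) = block_average n j y + block_average n j z" if z: "z \<in> nv_carrier Y" for z
    using bounded_functionalD(1)[OF c y z] by (simp add: block_average_def sum.distrib distrib_left)
  show "block_average n j (nv_scale Y a y) = a * block_average n j y" for a
    using bounded_functionalD(2)[OF c y, of _ a] by (simp add: block_average_def mult.left_commute flip: sum_distrib_left)
  let ?s = "\<Sum>c\<in>G n j. norm (coord n c y)"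
  have "?s powr p \<le> real (k n) powr (p - 1) * (\<Sum>c\<in>G n j. norm (coord n c y) powr p)"
    using power_mean[of p "G n j" "\<lambda>c. norm (coord n c y)"] p finite_G[OF j] G(2)[OF j] by simp
  also have "\<dots> \<le> real (k n) powr (p - 1) * (\<Sum>c<d n. norm (coord n c y) powr p)"
    using G(1)[OF j] by (intro mult_left_mono sum_mono2) auto
  also have "\<dots> \<le> real (k n) powr (p - 1) * nv_norm Y y powr p"
    by (intro mult_left_mono coord_sum_le y) auto
  finally have "(?s powr p) powr (1 / p) \<le> (real (k n) powr (p - 1) * nv_norm Y y powr p) powr (1 / p)"
    using p by (intro powr_mono2) auto
  moreover have "(p - 1) / p = 1 / p'"
  proof -
    have "1 / p' = 1 - 1 / p" using p(3) by simp
    then show ?thesis using p by (simp add: diff_divide_distrib)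
  qed
  ultimately have s: "?s \<le> real (k n) powr (1 / p') * nv_norm Y y"
    using p norm_nonneg[OF y] by (simp add: powr_mult powr_powr sum_nonneg)
  have "norm (block_average n j y) \<le> real (k n) powr - (1 / p') * ?s"
    by (simp add: block_average_def norm_mult mult_left_mono norm_sum)
  also have "\<dots> \<le> real (k n) powr - (1 / p') * (real (k n) powr (1 / p') * nv_norm Y y)"
    using s by (intro mult_left_mono) auto
  also have "\<dots> = 1 * nv_norm Y y"
    using k_pos[of n] by (simp add: powr_minus)
  finally show "norm (block_average n j y) \<le> 1 * nv_norm Y y" .
qed

lemma block_vector_mem:
  assumes i: "i < N n"
  shows "block_vector n i \<in> nv_carrier Y" "nv_norm Y (block_vector n i) \<le> 1"
proof -
  note F = conjunct1[OF block_subset[OF i]] conjunct2[OF block_subset[OF i]]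
  show c: "block_vector n i \<in> nv_carrier Y" unfolding block_vector_def by (rule comb_carrier[OF F])
  have "nv_norm Y (block_vector n i) powr p \<le> real (k n) * (real (k n) powr - (1 / p)) powr p"
    using comb_norm[OF F, of "\<lambda>_. of_real (real (k n) powr - (1 / p))"] G(2)[OF i]
    by (simp add: block_vector_def card_cartesian_product_singleton)
  also have "\<dots> = real (k n) * real (k n) powr - 1"
    using p(1) by (simp only: powr_powr) simp
  also have "\<dots> = 1 powr p" using k_pos[of n] by (simp add: powr_minus)
  finally show "nv_norm Y (block_vector n i) \<le> 1"
    using p norm_nonneg[OF c] powr_less_mono2[of p 1 "nv_norm Y (block_vector n i)"] by fastforce
qed

lemma functional_block_vector:
  assumes i: "i < N n" and f: "bounded_functional Y K f"
  shows "f (block_vector n i) = of_real (real (k n) powr - (1 / p)) * (\<Sum>z\<in>{n} \<times> G n i. f (comb {z} (\<lambda>_. 1)))"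
proof -
  note F = conjunct1[OF block_subset[OF i]] conjunct2[OF block_subset[OF i]]
  show ?thesis unfolding block_vector_def functional_comb[OF f F] sum_distrib_left ..
qed

lemma block_average_block_vector:
  assumes i: "i < N n"
  shows "block_average n i (block_vector n i) = 1"
proof -
  have "coord n c (block_vector n i) = of_real (real (k n) powr - (1 / p))" if "c \<in> G n i" for c
    using that block_subset[OF i] G(1)[OF i] unfolding block_vector_def by (subst coord_comb) auto
  then have "block_average n i (block_vector n i) = of_real (real (k n) powr - (1 / p') * (real (k n) * real (k n) powr - (1 / p)))"
    using G(2)[OF i] by (simp add: block_average_def)
  also have "real (k n) powr - (1 / p') * (real (k n) * real (k n) powr - (1 / p))
      = real (k n) powr (- (1 / p') + 1 + - (1 / p))"
    using k_pos[of n] by (simp only: powr_add powr_one of_nat_0_le_iff)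
  also have "- (1 / p') + 1 + - (1 / p) = 0" using p(3) by simp
  finally show ?thesis using k_pos[of n] by simp
qed

text \<open>\<open>finite_card_large_averages\<close> for the coordinates of \<open>y\<close> in
  block \<open>n\<close>, with \<open>a = n\<close> and size condition \<open>k_self\<close>. The
  bound does not depend on \<open>N n\<close>.\<close>

lemma card_large_block_average_le:
  assumes y: "y \<in> nv_carrier Y" "nv_norm Y y \<le> K" and K: "0 < K" and \<epsilon>: "0 < \<epsilon>"
    and n: "2 * K / \<epsilon> \<le> real n"
  shows "card {j. j < N n \<and> \<epsilon> \<le> norm (block_average n j y)} \<le> n ^ e"
proof -
  have "finite {j. j < N n \<and> \<epsilon> \<le> norm (block_average n j y)} \<and> card {j. j < N n \<and> \<epsilon> \<le> norm (block_average n j y)} \<le> n ^ e"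
  proof (rule finite_card_large_averages[where G = "G n" and k = "\<lambda>_. k n" and D = "{..<d n}"
        and \<phi> = "\<lambda>c. coord n c y" and p = p and p' = p' and K = K and \<epsilon> = \<epsilon> and r = r])
    fix F assume "finite F" "F \<subseteq> {..<d n}"
    then have "(\<Sum>c\<in>F. norm (coord n c y) powr p) \<le> (\<Sum>c<d n. norm (coord n c y) powr p)"
      by (intro sum_mono2) auto
    also have "\<dots> \<le> nv_norm Y y powr p" by (rule coord_sum_le[OF y(1)])
    also have "\<dots> \<le> K powr p" using p y(2) norm_nonneg[OF y(1)] by (intro powr_mono2) auto
    finally show "(\<Sum>c\<in>F. norm (coord n c y) powr p) \<le> K powr p" .
  next
    fix j assume "j \<in> {j. j < N n \<and> \<epsilon> \<le> norm (block_average n j y)}"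
    then have "\<epsilon> \<le> real (k n) powr - (1 / p') * norm (\<Sum>c\<in>G n j. coord n c y)"
      by (simp add: block_average_def norm_mult)
    then show "\<epsilon> * real (k n) powr (1 / p') \<le> norm (\<Sum>c\<in>G n j. coord n c y)"
      using k_pos[of n] by (simp add: powr_minus field_simps)
  qed (use p K \<epsilon> n e k_self k_pos G finite_G meet in auto)
  then show ?thesis by blast
qed

text \<open>The same count in the dual: by \<open>dual_norm_le\<close> the values of
  \<open>f\<close> at the coordinate vectors have bounded \<open>p'\<close>-norm, so
  \<open>p\<close> and \<open>p'\<close> change places, and the sets of all blocks after
  \<open>n\<close> are treated at once. Here \<open>a = n * d n\<close>, with size condition
  \<open>k_later\<close>.\<close>

lemma card_large_block_vector_le:
  assumes f: "bounded_functional Y K f" and K: "0 < K" and \<delta>: "0 < \<delta>"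
    and n: "2 * K / \<delta> \<le> real (n * d n)"
  shows "finite {(m, i). n < m \<and> i < N m \<and> \<delta> \<le> norm (f (block_vector m i))} \<and>
    card {(m, i). n < m \<and> i < N m \<and> \<delta> \<le> norm (f (block_vector m i))} \<le> (n * d n) ^ e"
proof (rule finite_card_large_averages[where G = "\<lambda>(m, i). {m} \<times> G m i" and k = "\<lambda>(m, i). k m"
      and D = "SIGMA n:UNIV. {..<d n}" and \<phi> = "\<lambda>z. f (comb {z} (\<lambda>_. 1))" and p = p' and p' = p
      and K = K and \<epsilon> = \<delta> and r = r])
  show "1 / p' + 1 / p = 1" using p by simp
next
  fix u assume "u \<in> {(m, i). n < m \<and> i < N m \<and> \<delta> \<le> norm (f (block_vector m i))}"
  then show "finite ((\<lambda>(m, i). {m} \<times> G m i) u) \<and>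
      card ((\<lambda>(m, i). {m} \<times> G m i) u) = (case u of (m, i) \<Rightarrow> k m) \<and> 0 < (case u of (m, i) \<Rightarrow> k m) \<and>
      (\<lambda>(m, i). {m} \<times> G m i) u \<subseteq> (SIGMA n:UNIV. {..<d n})"
    using block_subset G(2) k_pos by (auto simp: card_cartesian_product_singleton)
next
  fix u v assume "u \<in> {(m, i). n < m \<and> i < N m \<and> \<delta> \<le> norm (f (block_vector m i))}"
    "v \<in> {(m, i). n < m \<and> i < N m \<and> \<delta> \<le> norm (f (block_vector m i))}" "u \<noteq> v"
  then obtain m i m' j where u: "u = (m, i)" "v = (m', j)" "i < N m" "j < N m'" "(m, i) \<noteq> (m', j)" by auto
  \<comment> \<open>Sets from different blocks are disjoint, so \<open>meet\<close> within a block
    suffices.\<close>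
  have "({m} \<times> G m i) \<inter> ({m'} \<times> G m' j) = (if m = m' then {m} \<times> (G m i \<inter> G m' j) else {})" by auto
  then show "card ((\<lambda>(m, i). {m} \<times> G m i) u \<inter> (\<lambda>(m, i). {m} \<times> G m i) v) \<le> r"
    using u meet[of i m j] by (auto simp: card_cartesian_product_singleton)
next
  fix u assume "u \<in> {(m, i). n < m \<and> i < N m \<and> \<delta> \<le> norm (f (block_vector m i))}"
  then obtain m i where u: "u = (m, i)" "i < N m" "\<delta> \<le> norm (f (block_vector m i))" by auto
  have "\<delta> \<le> real (k m) powr - (1 / p) * norm (\<Sum>z\<in>{m} \<times> G m i. f (comb {z} (\<lambda>_. 1)))"
    using u(3) functional_block_vector[OF u(2) f] by (simp add: norm_mult)
  then show "\<delta> * real (case u of (m, i) \<Rightarrow> k m) powr (1 / p)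
      \<le> norm (\<Sum>z\<in>(\<lambda>(m, i). {m} \<times> G m i) u. f (comb {z} (\<lambda>_. 1)))"
    using k_pos[of m] by (simp add: u(1) powr_minus field_simps)
qed (use p K \<delta> n e k_later dual_norm_le[OF f K] in auto)

section \<open>The operators attached to sets of blocks\<close>

text \<open>The prescribed images of the unit vectors: the index \<open>l\<close> is read as a pair
  \<open>(m, i)\<close>, and pairs that name no block vector with \<open>m \<in> B\<close> are sent
  to zero, written as the empty combination.\<close>

definition source :: "nat set \<Rightarrow> nat \<Rightarrow> 'w" where
  "source B l = (case prod_decode l of (m, i) \<Rightarrow>
     if m \<in> B \<and> i < N m then block_vector m i else comb {} (\<lambda>_. 0))"

lemma source_mem: "source B l \<in> nv_carrier Y \<and> nv_norm Y (source B l) \<le> 1"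
proof -
  have "nv_norm Y (comb {} a) \<le> 0" for a
    using comb_norm[of "{}" a] by simp
  then have "comb {} a \<in> nv_carrier Y \<and> nv_norm Y (comb {} a) \<le> 1" for a
    using comb_carrier[of "{}" a] by (smt (verit) empty_subsetI finite.emptyI)
  then show ?thesis using block_vector_mem by (simp add: source_def split: prod.split)
qed

lemma functional_source:
  assumes "bounded_functional Y K f" "f (source B l) \<noteq> 0"
  obtains m i where "m \<in> B" "i < N m" "source B l = block_vector m i"
proof -
  have "f (comb {} a) = 0" for a using functional_comb[OF assms(1), of "{}" a] by simp
  with assms(2) that show thesis by (auto simp: source_def split: prod.splits if_splits)
qed

text \<open>For large \<open>n\<close> in \<open>A\<close>, an average in block \<open>n\<close>
  that is large on the image of the unit ball under \<open>U T\<close> is large on \<open>U\<close>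
  of one block vector \<open>(m, i)\<close> with \<open>m \<in> B\<close>, hence
  \<open>m \<noteq> n\<close>. The relevant pairs form \<open>Q\<close>: all earlier ones, and the
  later ones whose image has a large coordinate in block \<open>n\<close>. Each pair makes at most
  \<open>n ^ e\<close> averages large, and \<open>N_large\<close> compares
  \<open>card Q * n ^ e\<close> with \<open>N n\<close>.\<close>

lemma negligible_compose:
  assumes fin: "finite (A \<inter> B)" and U: "bounded_operator Y Y U"
    and T: "bounded_operator (ell 1) Y T" and unit: "\<And>l. T (unit_seq l) = source B l"
  shows "negligible (ell 1) N block_average A (\<lambda>v. U (T v))"
  unfolding negligible_def
proof (intro allI impI)
  fix \<epsilon> :: real assume \<epsilon>: "0 < \<epsilon>"
  have n1: "normed_nspace (ell 1 :: ('k, nat \<Rightarrow> 'k) nspace)" by (rule normed_nspace_ell) simp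
  obtain K where K: "1 \<le> K" "\<And>y. y \<in> nv_carrier Y \<Longrightarrow> nv_norm Y (U y) \<le> K * nv_norm Y y"
    using bounded_operator_bound[OF U] normed_nspace_axioms by blast
  obtain L where L: "1 \<le> L" "\<And>v. v \<in> nv_carrier (ell 1) \<Longrightarrow> nv_norm Y (T v) \<le> L * nv_norm (ell 1) v"
    using bounded_operator_bound[OF T n1] by blast
  obtain nB where nB: "\<And>n. n \<in> A \<inter> B \<Longrightarrow> n < nB"
    using fin by (meson finite_nat_set_iff_bounded)
  \<comment> \<open>Thresholds will be halved, so \<open>2 * K / (\<epsilon> / 2)\<close> has to be
    at most \<open>n\<close>; as \<open>1 \<le> K\<close>, this also gives
    \<open>1 / n \<le> \<epsilon>\<close>.\<close>
  obtain nK :: nat where nK: "4 * K / \<epsilon> \<le> real nK" using real_arch_simple by blast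
  have "real (card (large_indices (ell 1) N block_average (\<lambda>v. U (T v)) \<epsilon> n)) \<le> \<epsilon> * real (N n)"
    if n: "max nB nK \<le> n" "n \<in> A" for n
  proof -
    have notB: "n \<notin> B" using nB n by force
    have nKn: "4 * K / \<epsilon> \<le> real n" using nK n(1) by linarith
    have n0: "0 < real n"
      using nKn K(1) \<epsilon> by (smt (verit) divide_pos_pos)
    \<comment> \<open>If all \<open>d n\<close> coordinates are below \<open>\<delta>\<close>, the
      sum of their norms is below \<open>\<epsilon> / 2\<close>.\<close>
    define \<delta> where "\<delta> = \<epsilon> / (2 * real (d n))"
    define I where "I c = {(m, i). n < m \<and> i < N m \<and> \<delta> \<le> norm (coord n c (U (block_vector m i)))}" for c
    define Q where "Q = (SIGMA m:{..<n}. {..<N m}) \<union> (\<Union>c<d n. I c)"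
    define E where "E z = {j. j < N n \<and> \<epsilon> / 2 \<le> norm (block_average n j (U (block_vector (fst z) (snd z))))}" for z
    have d0: "0 < d n"
    proof -
      have "G n 0 \<noteq> {}" using G(2)[OF N_pos[of n]] k_pos[of n] by auto
      then show ?thesis using G(1)[OF N_pos[of n]] by auto
    qed
    have I: "finite (I c) \<and> card (I c) \<le> (n * d n) ^ e" if "c < d n" for c
      unfolding I_def
    proof (rule card_large_block_vector_le)
      show "bounded_functional Y (1 * K) (\<lambda>y. coord n c (U y))"
        by (rule bounded_functional_compose[OF U coord_functional[OF that] K(2)]) auto
      show "0 < \<delta>" using \<epsilon> d0 by (simp add: \<delta>_def)
      have "2 * (1 * K) / \<delta> = 4 * K / \<epsilon> * real (d n)" using d0 by (simp add: \<delta>_def)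
      also have "\<dots> \<le> real n * real (d n)" by (intro mult_right_mono nKn) auto
      finally show "2 * (1 * K) / \<delta> \<le> real (n * d n)" by simp
    qed (use K in auto)
    have finQ: "finite Q" using I by (auto simp: Q_def)
    have cardQ: "card Q \<le> (\<Sum>m<n. N m) + d n * (n * d n) ^ e"
    proof -
      have "card (\<Union>c<d n. I c) \<le> (\<Sum>c<d n. card (I c))" by (rule card_UN_le) simp
      also have "\<dots> \<le> (\<Sum>c<d n. (n * d n) ^ e)" using I by (intro sum_mono) auto
      finally have "card (\<Union>c<d n. I c) \<le> d n * (n * d n) ^ e" by simp
      moreover have "card (SIGMA m:{..<n}. {..<N m}) = (\<Sum>m<n. N m)" by simp
      ultimately show ?thesis unfolding Q_def using card_Un_le le_trans add_left_mono by metis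
    qed
    have Qt: "block_vector (fst z) (snd z) \<in> nv_carrier Y \<and> nv_norm Y (block_vector (fst z) (snd z)) \<le> 1" if "z \<in> Q" for z
      using that block_vector_mem by (auto simp: Q_def I_def)
    have cardE: "card (E z) \<le> n ^ e" if z: "z \<in> Q" for z
      unfolding E_def
    proof (rule card_large_block_average_le)
      show "U (block_vector (fst z) (snd z)) \<in> nv_carrier Y" using Qt[OF z] bounded_operatorD(1)[OF U] by blast
      show "nv_norm Y (U (block_vector (fst z) (snd z))) \<le> K"
        using K(2)[of "block_vector (fst z) (snd z)"] Qt[OF z] mult_left_mono[of "nv_norm Y (block_vector (fst z) (snd z))" 1 K] K(1)
        by linarith
      show "2 * K / (\<epsilon> / 2) \<le> real n" using nKn by simp
    qed (use K \<epsilon> in auto)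
    have "large_indices (ell 1) N block_average (\<lambda>v. U (T v)) \<epsilon> n \<subseteq> (\<Union>z\<in>Q. E z)"
    proof
      fix j assume "j \<in> large_indices (ell 1) N block_average (\<lambda>v. U (T v)) \<epsilon> n"
      then obtain v where j: "j < N n" and v: "v \<in> nv_carrier (ell 1)" "nv_norm (ell 1) v \<le> 1"
          "\<epsilon> \<le> norm (block_average n j (U (T v)))"
        unfolding large_indices_def by blast
      have xU: "bounded_functional Y (1 * K) (\<lambda>y. block_average n j (U y))"
        by (rule bounded_functional_compose[OF U block_average_functional[OF j] K(2)]) auto
      have xUT: "bounded_functional (ell 1) (1 * K * L) (\<lambda>v. block_average n j (U (T v)))"
        using K(1) by (intro bounded_functional_compose[OF T xU L(2)]) auto
      \<comment> \<open>From the unit ball of \<open>ell 1\<close> to a single unit vector; halving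
        the threshold provides the strict inequality for the contradiction.\<close>
      have "\<exists>l. \<epsilon> / 2 \<le> norm (block_average n j (U (source B l)))"
      proof (rule ccontr)
        assume "\<not> ?thesis"
        then have "norm (block_average n j (U (T (unit_seq l)))) \<le> \<epsilon> / 2" for l
          by (simp add: unit not_le less_imp_le)
        from ell_one_functional_le[OF xUT this v(1)] have "\<epsilon> \<le> \<epsilon> / 2 * nv_norm (ell 1) v"
          using v(3) by linarith
        also have "\<dots> \<le> \<epsilon> / 2 * 1" using v(2) \<epsilon> by (intro mult_left_mono) auto
        finally show False using \<epsilon> by simp
      qed
      then obtain l where l: "\<epsilon> / 2 \<le> norm (block_average n j (U (source B l)))" by blast
      then have "block_average n j (U (source B l)) \<noteq> 0" using \<epsilon> by auto
      then obtain m i where mi: "m \<in> B" "i < N m" "source B l = block_vector m i"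
        by (rule functional_source[OF xU])
      have "(m, i) \<in> Q"
      proof (cases "m < n")
        case True
        then show ?thesis using mi by (simp add: Q_def)
      next
        case False
        \<comment> \<open>\<open>m = n\<close> is excluded since \<open>m \<in> B\<close> and
          \<open>n \<notin> B\<close>: here finiteness of \<open>A \<inter> B\<close>
          enters.\<close>
        then have nm: "n < m" using notB mi(1) by (metis linorder_neqE_nat)
        have "\<exists>c<d n. \<delta> \<le> norm (coord n c (U (block_vector m i)))"
        proof (rule ccontr)
          assume "\<not> ?thesis"
          then have small: "norm (coord n c (U (block_vector m i))) < \<delta>" if "c < d n" for c using that by force
          have "norm (block_average n j (U (block_vector m i))) \<le> real (k n) powr - (1 / p') * (\<Sum>c\<in>G n j. norm (coord n c (U (block_vector m i))))"
            by (simp add: block_average_def norm_mult mult_left_mono norm_sum)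
          also have "\<dots> \<le> 1 * (\<Sum>c\<in>G n j. norm (coord n c (U (block_vector m i))))"
          proof (intro mult_right_mono sum_nonneg)
            have "real (k n) powr - (1 / p') \<le> real (k n) powr 0"
              using p k_pos[of n] by (intro powr_mono) auto
            then show "real (k n) powr - (1 / p') \<le> 1" using k_pos[of n] by simp
          qed auto
          also have "\<dots> \<le> (\<Sum>c<d n. norm (coord n c (U (block_vector m i))))"
            using G(1)[OF j] by (simp, intro sum_mono2) auto
          also have "\<dots> < (\<Sum>c<d n. \<delta>)"
            using d0 small by (intro sum_strict_mono) auto
          also have "\<dots> = \<epsilon> / 2" using d0 by (simp add: \<delta>_def)
          finally show False using l mi(3) by simp
        qed
        then show ?thesis using nm mi(2) by (auto simp: Q_def I_def)
      qed
      moreover have "j \<in> E (m, i)" using j l mi(3) by (simp add: E_def)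
      ultimately show "j \<in> (\<Union>z\<in>Q. E z)" by blast
    qed
    then have "card (large_indices (ell 1) N block_average (\<lambda>v. U (T v)) \<epsilon> n) \<le> card (\<Union>z\<in>Q. E z)"
      using finQ by (intro card_mono) (auto simp: E_def)
    also have "\<dots> \<le> (\<Sum>z\<in>Q. card (E z))" by (rule card_UN_le[OF finQ])
    also have "\<dots> \<le> card Q * n ^ e" using sum_mono[OF cardE] by simp
    also have "\<dots> \<le> ((\<Sum>m<n. N m) + d n * (n * d n) ^ e) * n ^ e"
      using cardQ by (rule mult_right_mono) simp
    finally have "card (large_indices (ell 1) N block_average (\<lambda>v. U (T v)) \<epsilon> n) * n \<le> N n"
      using N_large[of n] by (meson le_trans mult_le_mono1)
    then have "real (card (large_indices (ell 1) N block_average (\<lambda>v. U (T v)) \<epsilon> n)) * real n \<le> real (N n)"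
      by (metis of_nat_le_iff of_nat_mult)
    then have "real (card (large_indices (ell 1) N block_average (\<lambda>v. U (T v)) \<epsilon> n)) \<le> real (N n) / real n"
      using n0 by (simp add: le_divide_eq)
    also have "\<dots> \<le> \<epsilon> * real (N n)"
    proof -
      have "1 \<le> \<epsilon> * real n" using nKn K(1) \<epsilon> by (simp add: divide_le_eq mult.commute)
      then have "1 * real (N n) \<le> \<epsilon> * real n * real (N n)" by (intro mult_right_mono) auto
      then show ?thesis using n0 by (simp add: divide_le_eq mult_ac)
    qed
    finally show ?thesis .
  qed
  then show "\<exists>n0. \<forall>n\<ge>n0. n \<in> A \<longrightarrow> real (card (large_indices (ell 1) N block_average (\<lambda>v. U (T v)) \<epsilon> n)) \<le> \<epsilon> * real (N n)"
    by blast
qed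

text \<open>For \<open>n\<close> in \<open>A\<close>, every average of block \<open>n\<close> takes
  the value 1 at its own block vector, which is the image of a unit vector; so all
  \<open>N n\<close> indices are large.\<close>

lemma not_negligible:
  assumes A: "infinite A" and unit: "\<And>l. T (unit_seq l) = source A l"
  shows "\<not> negligible (ell 1) N block_average A T"
proof
  assume "negligible (ell 1) N block_average A T"
  then obtain n0 where n0: "\<And>n. n0 \<le> n \<Longrightarrow> n \<in> A \<Longrightarrow>
      real (card (large_indices (ell 1) N block_average T (1 / 2) n)) \<le> 1 / 2 * real (N n)"
    unfolding negligible_def by (metis half_gt_zero zero_less_one)
  obtain n where n: "n0 \<le> n" "n \<in> A" using A infinite_nat_iff_unbounded_le by blast
  have "large_indices (ell 1) N block_average T (1 / 2) n = {..<N n}"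
  proof -
    have "\<exists>v\<in>nv_carrier (ell 1). nv_norm (ell 1) v \<le> 1 \<and> 1 / 2 \<le> norm (block_average n j (T v))" if j: "j < N n" for j
    proof (intro bexI conjI)
      have "source A (prod_encode (n, j)) = block_vector n j" using n j by (simp add: source_def)
      then show "1 / 2 \<le> norm (block_average n j (T (unit_seq (prod_encode (n, j)))))" using unit block_average_block_vector[OF j] by simp
    qed (simp_all add: unit_seq_ell)
    then show ?thesis by (auto simp: large_indices_def)
  qed
  then show False using n0[OF n] N_pos[of n] by simp
qed

text \<open>A set \<open>S\<close> of reals can be read off from its ideal: for an almost disjoint
  family \<open>A s\<close>, the operator of \<open>A s\<close> lies in the ideal of the sets
  \<open>A s'\<close>, \<open>s' \<in> S\<close>, exactly if \<open>s \<notin> S\<close>.\<close>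

lemma Pow_real_lepoll_closed_ideals:
  "Pow (UNIV :: real set) \<lesssim> closed_ideals (ell 1) Y"
proof -
  \<comment> \<open>Coded graphs of the functions sending \<open>n\<close> to the floor of
    \<open>n * s\<close>. For \<open>s \<noteq> s'\<close> the floors differ once
    \<open>n * \<bar>s - s'\<bar> \<ge> 1\<close>, so two graphs have finitely many common
    points.\<close>
  define A :: "real \<Rightarrow> nat set" where "A s = range (\<lambda>n. to_nat (n, \<lfloor>real n * s\<rfloor>))" for s
  have inf: "infinite (A s)" for s
    unfolding A_def by (rule range_inj_infinite) (simp add: inj_def)
  have fin: "finite (A s \<inter> A s')" if "s \<noteq> s'" for s s'
  proof -
    obtain m :: nat where m: "1 / \<bar>s - s'\<bar> < real m" using reals_Archimedean2 by blast
    have "A s \<inter> A s' \<subseteq> (\<lambda>n. to_nat (n, \<lfloor>real n * s\<rfloor>)) ` {..<m}"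
    proof
      fix a assume "a \<in> A s \<inter> A s'"
      then obtain n where n: "a = to_nat (n, \<lfloor>real n * s\<rfloor>)" "\<lfloor>real n * s\<rfloor> = \<lfloor>real n * s'\<rfloor>"
        by (auto simp: A_def)
      have "\<bar>real n * s - real n * s'\<bar> < 1" using n(2) by linarith
      then have "real n * \<bar>s - s'\<bar> < 1" by (simp add: abs_mult flip: right_diff_distrib)
      then have "real n < 1 / \<bar>s - s'\<bar>" using that by (simp add: less_divide_eq)
      then have "n < m" using m by linarith
      then show "a \<in> (\<lambda>n. to_nat (n, \<lfloor>real n * s\<rfloor>)) ` {..<m}" using n(1) by blast
    qed
    then show ?thesis by (rule finite_subset) simp
  qed
  have "\<exists>T\<in>nv_carrier (operator_space (ell 1) Y). \<forall>l. T (unit_seq l) = source (A s) l" for s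
    by (rule ex_operator[OF source_mem])
  then obtain T where T: "\<And>s. T s \<in> nv_carrier (operator_space (ell 1) Y)"
      "\<And>s l. T s (unit_seq l) = source (A s) l"
    by metis
  let ?J = "\<lambda>S. vanishing_ideal (ell 1) Y N block_average (A ` S)"
  have n1: "normed_nspace (ell 1 :: ('k, nat \<Rightarrow> 'k) nspace)" by (rule normed_nspace_ell) simp
  have mem: "T s \<in> ?J S \<longleftrightarrow> s \<notin> S" for s S
  proof
    assume "T s \<in> ?J S"
    show "s \<notin> S"
    proof
      assume "s \<in> S"
      \<comment> \<open>The identity is one of the operators \<open>U\<close> in the definition of
        the ideal.\<close>
      moreover have "bounded_operator Y Y (\<lambda>y. y)"
        unfolding bounded_operator_def by (auto intro!: exI[of _ 1])
      ultimately have "negligible (ell 1) N block_average (A s) (T s)"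
        using \<open>T s \<in> ?J S\<close> by (auto simp: vanishing_ideal_def)
      then show False using not_negligible[OF inf T(2)] by blast
    qed
  next
    assume "s \<notin> S"
    then have "finite (A s' \<inter> A s)" if "s' \<in> S" for s' using that by (intro fin) auto
    then show "T s \<in> ?J S"
      using T(1)[of s] negligible_compose[OF _ _ _ T(2)]
      by (auto simp: vanishing_ideal_def in_operator_space)
  qed
  have "inj_on ?J (Pow UNIV)"
  proof (rule inj_onI)
    fix S S' assume "?J S = ?J S'"
    then show "S = S'" using mem by blast
  qed
  moreover have "?J ` Pow UNIV \<subseteq> closed_ideals (ell 1) Y"
    using vanishing_ideal_closed[OF n1 normed_nspace_axioms, of N block_average] block_average_functional by blast
  ultimately show ?thesis unfolding lepoll_def by blast
qed

end

subsection \<open>The target spaces and the cardinality\<close>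

text \<open>All sizes come from one parameter \<open>b n\<close> fed into
  \<open>ex_almost_disjoint_sets\<close>. It is chosen recursively to dominate \<open>n\<close>,
  \<open>H n\<close>, the number of sets in all earlier blocks, and the values
  \<open>H (m * d (b m))\<close> for \<open>m < n\<close>.\<close>

lemma ex_sparse_sequences:
  fixes e :: nat
  defines "H \<equiv> \<lambda>a. ((e + 1) * (a ^ e + 1) * a) ^ e"
  obtains k d N :: "nat \<Rightarrow> nat" and G :: "nat \<Rightarrow> nat \<Rightarrow> nat set"
  where "\<And>n i. i < N n \<Longrightarrow> G n i \<subseteq> {..<d n}" "\<And>n i. i < N n \<Longrightarrow> card (G n i) = k n"
    "\<And>n. 0 < k n" "\<And>n. 0 < N n"
    "\<And>n i j. i < N n \<Longrightarrow> j < N n \<Longrightarrow> i \<noteq> j \<Longrightarrow> card (G n i \<inter> G n j) \<le> e + 1"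
    "\<And>n. H n \<le> k n" "\<And>n m. n < m \<Longrightarrow> H (n * d n) \<le> k m"
    "\<And>n. ((\<Sum>m<n. N m) + d n * (n * d n) ^ e) * n ^ e * n \<le> N n"
proof -
  have "\<forall>b. \<exists>k d N. \<exists>G :: nat \<Rightarrow> nat set. b \<le> k \<and> 0 < k \<and> 0 < N \<and> (b + d * (b * d) ^ e) * b ^ (e + 1) \<le> N
     \<and> (\<forall>i<N. G i \<subseteq> {..<d} \<and> card (G i) = k)
     \<and> (\<forall>i<N. \<forall>j<N. i \<noteq> j \<longrightarrow> card (G i \<inter> G j) \<le> e + 1)"
    using ex_almost_disjoint_sets by blast
  then obtain k d N and G :: "nat \<Rightarrow> nat \<Rightarrow> nat set" where
    *: "\<And>b. b \<le> k b \<and> 0 < k b \<and> 0 < N b \<and> (b + d b * (b * d b) ^ e) * b ^ (e + 1) \<le> N b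
       \<and> (\<forall>i<N b. G b i \<subseteq> {..<d b} \<and> card (G b i) = k b)
       \<and> (\<forall>i<N b. \<forall>j<N b. i \<noteq> j \<longrightarrow> card (G b i \<inter> G b j) \<le> e + 1)"
    by metis
  \<comment> \<open>\<open>s n\<close> accumulates what the earlier blocks demand. The term
    \<open>s + H n + n\<close> is \<open>b n\<close>, written out because \<open>b\<close> is
    defined from \<open>s\<close>.\<close>
  define s where "s = rec_nat 0 (\<lambda>n s. s + N (s + H n + n) + H (n * d (s + H n + n)))"
  define b where "b n = s n + H n + n" for n
  have s_Suc: "s (Suc n) = s n + N (b n) + H (n * d (b n))" for n
    by (simp add: s_def b_def)
  have sumN: "(\<Sum>m<n. N (b m)) \<le> s n" for n
    by (induction n) (simp_all add: s_Suc)
  have later: "H (n * d (b n)) \<le> s m" if "n < m" for n m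
    using that by (induction m) (auto simp: s_Suc less_Suc_eq)
  show thesis
  proof (rule that[of "\<lambda>n. N (b n)" "\<lambda>n. G (b n)" "\<lambda>n. d (b n)" "\<lambda>n. k (b n)"])
    fix n
    show "H n \<le> k (b n)" using *[of "b n"] by (simp add: b_def)
    show "H (n * d (b n)) \<le> k (b m)" if "n < m" for m
      using later[OF that] *[of "b m"] by (simp add: b_def)
    have "(\<Sum>m<n. N (b m)) \<le> b n" "n \<le> b n"
      using sumN[of n] by (simp_all add: b_def)
    then have "((\<Sum>m<n. N (b m)) + d (b n) * (n * d (b n)) ^ e) * (n ^ e * n)
        \<le> (b n + d (b n) * (b n * d (b n)) ^ e) * (b n ^ e * b n)"
      by (intro mult_mono add_mono power_mono) auto
    also have "\<dots> \<le> N (b n)" using *[of "b n"] by (simp add: mult.commute)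
    finally show "((\<Sum>m<n. N (b m)) + d (b n) * (n * d (b n)) ^ e) * n ^ e * n \<le> N (b n)"
      by (simp add: mult.assoc)
  qed (use * in auto)
qed

text \<open>Coordinates are asked for with every \<open>d\<close>, since the block sizes are an
  outcome of the construction, which depends on the exponents only through \<open>e\<close>.\<close>

lemma Pow_real_lepoll_closed_ideals_if_coordinates:
  fixes Y :: "('k::{real_normed_field, banach}, 'w) nspace"
  assumes coord: "\<And>d. coordinate_space Y p p' d (coord d) (comb d)"
  shows "Pow (UNIV :: real set) \<lesssim> closed_ideals (ell 1) Y"
proof -
  obtain e :: nat where e: "max p p' \<le> real e" using real_arch_simple by blast
  obtain k d N G where
    "\<And>n i. i < N n \<Longrightarrow> G n i \<subseteq> {..<d n}" "\<And>n i. i < N n \<Longrightarrow> card (G n i) = k n"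
    "\<And>n. 0 < k n" "\<And>n. 0 < N n"
    "\<And>n i j. i < N n \<Longrightarrow> j < N n \<Longrightarrow> i \<noteq> j \<Longrightarrow> card (G n i \<inter> G n j) \<le> e + 1"
    "\<And>n. ((e + 1) * (n ^ e + 1) * n) ^ e \<le> k n"
    "\<And>n m. n < m \<Longrightarrow> ((e + 1) * ((n * d n) ^ e + 1) * (n * d n)) ^ e \<le> k m"
    "\<And>n. ((\<Sum>m<n. N m) + d n * (n * d n) ^ e) * n ^ e * n \<le> N n"
    using ex_sparse_sequences[of e] by metis
  then interpret sparse_scheme Y p p' d "coord d" "comb d" k N G e "e + 1"
    using e by (intro sparse_scheme.intro coord sparse_scheme_axioms.intro) auto
  show ?thesis by (rule Pow_real_lepoll_closed_ideals)
qed

section \<open>Block coordinates in the two target spaces\<close>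

text \<open>Coordinate \<open>c\<close> of block \<open>n\<close> sits at index
  \<open>prod_encode (n, c)\<close>, so different blocks occupy disjoint sets of indices and
  \<open>comb_norm\<close> is an equality. The conjugate exponent of \<open>q\<close> is
  \<open>q / (q - 1)\<close>.\<close>

lemma coordinate_space_ell:
  fixes d :: "nat \<Rightarrow> nat"
  assumes q: "1 < q"
  shows "coordinate_space (ell q :: ('k::{real_normed_field, banach}, nat \<Rightarrow> 'k) nspace) q (q / (q - 1)) d
    (\<lambda>n c y. y (prod_encode (n, c))) (\<lambda>F a i. if prod_decode i \<in> F then a (prod_decode i) else 0)"
    (is "coordinate_space ?E _ _ _ ?coord ?comb")
proof -
  interpret normed_nspace ?E using q by (intro normed_nspace_ell) simp
  have comb: "?comb F a \<in> nv_carrier ?E \<and> nv_norm ?E (?comb F a) powr q = (\<Sum>z\<in>F. norm (a z) powr q)"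
    if F: "finite F" for F a
  proof -
    have "(\<lambda>i. if i \<in> prod_encode ` F then norm (a (prod_decode i)) powr q else 0)
        sums (\<Sum>i\<in>prod_encode ` F. norm (a (prod_decode i)) powr q)"
      by (rule sums_If_finite_set) (simp add: F)
    moreover have "i \<in> prod_encode ` F \<longleftrightarrow> prod_decode i \<in> F" for i
      by (metis image_iff prod_decode_inverse prod_encode_inverse)
    then have "(\<lambda>i. if i \<in> prod_encode ` F then norm (a (prod_decode i)) powr q else 0)
        = (\<lambda>i. norm (?comb F a i) powr q)"
      using q by (intro ext) simp
    moreover have "(\<Sum>i\<in>prod_encode ` F. norm (a (prod_decode i)) powr q) = (\<Sum>z\<in>F. norm (a z) powr q)"
      by (subst sum.reindex) (auto intro: inj_on_subset[OF inj_prod_encode])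
    ultimately have "(\<lambda>i. norm (?comb F a i) powr q) sums (\<Sum>z\<in>F. norm (a z) powr q)" by simp
    then show ?thesis
      using q by (auto simp: ell_simps sums_iff powr_powr sum_nonneg)
  qed
  show ?thesis
  proof
    fix n and u :: "nat \<Rightarrow> 'k" assume u: "u \<in> nv_carrier ?E"
    have "(\<Sum>c<d n. norm (u (prod_encode (n, c))) powr q)
        = (\<Sum>i\<in>(\<lambda>c. prod_encode (n, c)) ` {..<d n}. norm (u i) powr q)"
      by (subst sum.reindex) (auto simp: inj_on_def)
    also have "\<dots> \<le> nv_norm ?E u powr q"
      using q by (intro ell_sum_le u) auto
    finally show "(\<Sum>c<d n. norm (u (prod_encode (n, c))) powr q) \<le> nv_norm ?E u powr q" .
  next
    fix c n
    show "bounded_functional ?E 1 (?coord n c)"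
      using q ell_coordinate_le[of q] by (auto simp: bounded_functional_def ell_simps(2,3))
  next
    fix F :: "(nat \<times> nat) set" and a :: "nat \<times> nat \<Rightarrow> 'k" assume "finite F"
    then show "?comb F a \<in> nv_carrier ?E" "nv_norm ?E (?comb F a) powr q \<le> (\<Sum>z\<in>F. norm (a z) powr q)"
      using comb by auto
  next
    fix y :: "nat \<Rightarrow> nat \<Rightarrow> 'k"
    assume "\<And>l. y l \<in> nv_carrier ?E \<and> nv_norm ?E (y l) \<le> 1"
    then show "\<exists>T\<in>nv_carrier (operator_space (ell 1) ?E). \<forall>l. T (unit_seq l) = y l"
      using q by (intro ell_ex_operator) auto
  qed (use q in \<open>auto simp: ell_simps(2,3) fun_eq_iff field_simps\<close>)
qed

text \<open>Block \<open>n\<close> sits in the summand with index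
  \<open>prod_encode (n, d n)\<close>. This index is injective in \<open>n\<close> and at least
  \<open>d n\<close>, so the summand has room for \<open>d n\<close> coordinates. The condition on
  \<open>m\<close> in the combination says that \<open>m\<close> is such an index.\<close>

lemma coordinate_space_c0_sum:
  fixes d :: "nat \<Rightarrow> nat"
  shows "coordinate_space
    (c0_sum (\<lambda>n. ell2_fin (Suc n)) :: ('k::{real_normed_field, banach}, nat \<Rightarrow> nat \<Rightarrow> 'k) nspace) 2 2 d
    (\<lambda>n c y. y (prod_encode (n, d n)) c)
    (\<lambda>F a m c. if m = prod_encode (fst (prod_decode m), d (fst (prod_decode m))) \<and> (fst (prod_decode m), c) \<in> F
       then a (fst (prod_decode m), c) else 0)"
    (is "coordinate_space ?E _ _ _ ?coord ?comb")
proof -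
  let ?X = "\<lambda>n. ell2_fin (Suc n) :: ('k, nat \<Rightarrow> 'k) nspace"
  interpret normed_nspace ?E by (intro normed_nspace_c0_sum normed_nspace_ell2_fin)
  have block_sum: "(\<Sum>c<d n. norm (u (prod_encode (n, d n)) c) ^ 2) \<le> nv_norm ?E u ^ 2"
    if u: "u \<in> nv_carrier ?E" for u n
  proof -
    let ?m = "prod_encode (n, d n)"
    have "d n \<le> Suc ?m" using le_prod_encode_2[of "d n" n] by simp
    then have "(\<Sum>c<d n. norm (u ?m c) ^ 2) \<le> (\<Sum>c<Suc ?m. norm (u ?m c) ^ 2)"
      by (intro sum_mono2) auto
    also have "\<dots> = nv_norm (?X ?m) (u ?m) ^ 2"
      by (simp add: ell2_fin_simps L2_set_def sum_nonneg del: sum.lessThan_Suc)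
    also have "\<dots> \<le> nv_norm ?E u ^ 2"
      using c0_sum_block_le[OF u, of ?m] by (intro power_mono) (auto simp: ell2_fin_simps L2_set_nonneg)
    finally show ?thesis .
  qed
  have comb: "?comb F a \<in> nv_carrier ?E \<and> nv_norm ?E (?comb F a) ^ 2 \<le> (\<Sum>z\<in>F. norm (a z) ^ 2)"
    if F: "finite F" "F \<subseteq> (SIGMA n:UNIV. {..<d n})" for F a
  proof -
    have c: "?comb F a \<in> nv_carrier ?E"
      unfolding c0_sum_simps mem_Collect_eq
    proof (intro conjI allI)
      fix m
      show "?comb F a m \<in> nv_carrier (?X m)"
        unfolding ell2_fin_simps mem_Collect_eq
      proof (intro allI impI)
        fix c assume "Suc m \<le> c"
        show "?comb F a m c = 0"
        proof (cases "m = prod_encode (fst (prod_decode m), d (fst (prod_decode m)))")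
          case True
          then have "d (fst (prod_decode m)) \<le> m" by (metis le_prod_encode_2)
          then show ?thesis using F(2) \<open>Suc m \<le> c\<close> by auto
        qed simp
      qed
    next
      have "nv_norm (?X m) (?comb F a m) = 0" if "m \<notin> (\<lambda>z. prod_encode (fst z, d (fst z))) ` F" for m
      proof -
        have "?comb F a m = (\<lambda>_. 0)" using that by (force simp: image_iff)
        then show ?thesis by (simp add: ell2_fin_simps L2_set_def)
      qed
      moreover obtain b where "(\<lambda>z. prod_encode (fst z, d (fst z))) ` F \<subseteq> {..<b}"
        using F(1) finite_nat_iff_bounded by blast
      ultimately have "\<forall>m\<ge>b. nv_norm (?X m) (?comb F a m) = 0" by force
      then show "(\<lambda>m. nv_norm (?X m) (?comb F a m)) \<longlonglongrightarrow> 0"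
        by (intro tendsto_eventually) (auto simp: eventually_sequentially)
    qed
    \<comment> \<open>A single summand sees only a part of \<open>F\<close>, so its Euclidean norm
      is at most that of all coefficients, and the supremum over the summands inherits the
      bound.\<close>
    have "nv_norm (?X m) (?comb F a m) \<le> sqrt (\<Sum>z\<in>F. norm (a z) ^ 2)" for m
    proof -
      let ?n = "fst (prod_decode m)"
      have "(\<Sum>c<Suc m. norm (?comb F a m c) ^ 2) \<le> (\<Sum>c<Suc m. if (?n, c) \<in> F then norm (a (?n, c)) ^ 2 else 0)"
        by (intro sum_mono) auto
      also have "\<dots> = (\<Sum>c\<in>{c\<in>{..<Suc m}. (?n, c) \<in> F}. norm (a (?n, c)) ^ 2)"
        by (rule sum.inter_filter[symmetric]) simp
      also have "\<dots> = (\<Sum>z\<in>Pair ?n ` {c\<in>{..<Suc m}. (?n, c) \<in> F}. norm (a z) ^ 2)"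
        by (subst sum.reindex) (auto simp: inj_on_def)
      also have "\<dots> \<le> (\<Sum>z\<in>F. norm (a z) ^ 2)"
        using F(1) by (intro sum_mono2) auto
      finally show ?thesis by (simp only: ell2_fin_simps L2_set_def real_sqrt_le_iff)
    qed
    then have "nv_norm ?E (?comb F a) \<le> sqrt (\<Sum>z\<in>F. norm (a z) ^ 2)" by (rule c0_sum_norm_le)
    then have "nv_norm ?E (?comb F a) ^ 2 \<le> sqrt (\<Sum>z\<in>F. norm (a z) ^ 2) ^ 2"
      by (intro power_mono norm_nonneg[OF c])
    then show ?thesis using c by (simp add: sum_nonneg)
  qed
  show ?thesis
  proof
    fix n and u :: "nat \<Rightarrow> nat \<Rightarrow> 'k" assume u: "u \<in> nv_carrier ?E"
    show "(\<Sum>c<d n. norm (u (prod_encode (n, d n)) c) powr 2) \<le> nv_norm ?E u powr 2"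
      using block_sum[OF u, of n] norm_nonneg[OF u] by (simp add: powr_numeral)
  next
    fix c n assume c: "c < d n"
    show "bounded_functional ?E 1 (?coord n c)"
      unfolding bounded_functional_def
    proof (intro conjI ballI allI)
      fix u :: "nat \<Rightarrow> nat \<Rightarrow> 'k" assume u: "u \<in> nv_carrier ?E"
      have "norm (?coord n c u) ^ 2 \<le> (\<Sum>c<d n. norm (?coord n c u) ^ 2)"
        using c by (intro member_le_sum) auto
      also have "\<dots> \<le> nv_norm ?E u ^ 2" by (rule block_sum[OF u])
      finally show "norm (?coord n c u) \<le> 1 * nv_norm ?E u"
        using power2_le_imp_le[OF _ norm_nonneg[OF u]] by simp
    qed (simp_all add: c0_sum_simps ell2_fin_simps)
  next
    fix F :: "(nat \<times> nat) set" and a :: "nat \<times> nat \<Rightarrow> 'k"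
    assume F: "finite F" "F \<subseteq> (SIGMA n:UNIV. {..<d n})"
    show c: "?comb F a \<in> nv_carrier ?E" using comb[OF F, of a] by (rule conjunct1)
    show "nv_norm ?E (?comb F a) powr 2 \<le> (\<Sum>z\<in>F. norm (a z) powr 2)"
      using comb[OF F, of a] norm_nonneg[OF c] by (simp add: powr_numeral)
  next
    fix F :: "(nat \<times> nat) set" and a :: "nat \<times> nat \<Rightarrow> 'k" and z assume "z \<notin> F"
    then show "?comb (insert z F) a = nv_add ?E (nv_scale ?E (a z) (?comb {z} (\<lambda>_. 1))) (?comb F a)"
      by (auto simp: c0_sum_simps(2,3) ell2_fin_simps(2,3) fun_eq_iff)
  next
    fix y :: "nat \<Rightarrow> nat \<Rightarrow> nat \<Rightarrow> 'k"
    assume "\<And>l. y l \<in> nv_carrier ?E \<and> nv_norm ?E (y l) \<le> 1"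
    then show "\<exists>T\<in>nv_carrier (operator_space (ell 1) ?E). \<forall>l. T (unit_seq l) = y l"
      by (rule c0_sum_ell2_fin_ex_operator)
  qed (simp_all add: c0_sum_simps(3) ell2_fin_simps(3))
qed

section \<open>The upper bound for the number of closed ideals\<close>

text \<open>\<open>ell_one_functional_le\<close> with bound 0, applied to the difference of the two
  functionals on \<open>ell 1\<close>.\<close>

lemma functional_eq_if_eq_on_units:
  assumes S: "bounded_operator (ell 1) Y S" and T: "bounded_operator (ell 1) Y T"
    and f: "bounded_functional Y 1 f"
    and eq: "\<And>l. S (unit_seq l) = T (unit_seq l)" and v: "v \<in> nv_carrier (ell 1)"
  shows "f (S v) = f (T v)"
proof -
  have n1: "normed_nspace (ell 1 :: ('a, nat \<Rightarrow> 'a) nspace)" by (rule normed_nspace_ell) simp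
  obtain K where K: "\<And>v. v \<in> nv_carrier (ell 1) \<Longrightarrow> nv_norm Y (S v) \<le> K * nv_norm (ell 1) v"
    using bounded_operator_bound[OF S n1] by blast
  obtain L where L: "\<And>v. v \<in> nv_carrier (ell 1) \<Longrightarrow> nv_norm Y (T v) \<le> L * nv_norm (ell 1) v"
    using bounded_operator_bound[OF T n1] by blast
  have fS: "bounded_functional (ell 1) (1 * K) (\<lambda>v. f (S v))"
    by (rule bounded_functional_compose[OF S f K]) auto
  have fT: "bounded_functional (ell 1) (1 * L) (\<lambda>v. f (T v))"
    by (rule bounded_functional_compose[OF T f L]) auto
  have "bounded_functional (ell 1) (K + L) (\<lambda>v. f (S v) - f (T v))"
    unfolding bounded_functional_def
  proof (intro conjI ballI allI)
    fix v :: "nat \<Rightarrow> 'a" assume v: "v \<in> nv_carrier (ell 1)"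
    show "norm (f (S v) - f (T v)) \<le> (K + L) * nv_norm (ell 1) v"
      using norm_triangle_ineq4[of "f (S v)" "f (T v)"] bounded_functionalD(3)[OF fS v]
        bounded_functionalD(3)[OF fT v] by (simp add: distrib_right)
  qed (simp_all add: bounded_functionalD(1,2)[OF fS] bounded_functionalD(1,2)[OF fT] algebra_simps)
  from ell_one_functional_le[OF this _ v, of 0] show ?thesis by (simp add: eq)
qed

text \<open>A sequence of sets of naturals is coded as one set of pairs; in cardinals, a countable
  power of the continuum is the continuum.\<close>

lemma fun_nat_lepoll_nat_sets:
  assumes "(UNIV :: 'a set) \<lesssim> (UNIV :: nat set set)"
  shows "(UNIV :: (nat \<Rightarrow> 'a) set) \<lesssim> (UNIV :: nat set set)"
proof -
  obtain h :: "'a \<Rightarrow> nat set" where h: "inj h" using assms by (auto simp: lepoll_def)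
  define g where "g f = prod_encode ` (SIGMA l:UNIV. h (f l))" for f :: "nat \<Rightarrow> 'a"
  have "inj g"
  proof (rule injI)
    fix f f' assume "g f = g f'"
    then have "(SIGMA l:UNIV. h (f l)) = (SIGMA l:UNIV. h (f' l))"
      unfolding g_def by (simp add: inj_image_eq_iff[OF inj_prod_encode])
    then have "h (f l) = h (f' l)" for l by (auto simp: set_eq_iff)
    then show "f = f'" using h by (auto simp: inj_def)
  qed
  then show ?thesis by (auto simp: lepoll_def)
qed

text \<open>An operator on \<open>ell 1\<close> is determined by the sequence of its values at the
  unit vectors, so there are at most continuum many operators, and a closed ideal is a set of
  operators. Separation by functionals reduces equality in \<open>Y\<close> to equality of
  scalars.\<close>

lemma closed_ideals_lepoll_Pow_real:
  fixes Y :: "('k::real_normed_field, 'w) nspace"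
  assumes w: "(UNIV :: 'w set) \<lesssim> (UNIV :: nat set set)"
    and sep: "\<And>y z. y \<in> nv_carrier Y \<Longrightarrow> z \<in> nv_carrier Y \<Longrightarrow>
      (\<And>f. bounded_functional Y 1 f \<Longrightarrow> f y = f z) \<Longrightarrow> y = z"
  shows "closed_ideals (ell 1) Y \<lesssim> Pow (UNIV :: real set)"
proof -
  let ?C = "nv_carrier (operator_space (ell 1) Y)"
  have "inj_on (\<lambda>T l. T (unit_seq l)) ?C"
  proof (rule inj_onI)
    fix S T assume S: "S \<in> ?C" and T: "T \<in> ?C" and "(\<lambda>l. S (unit_seq l)) = (\<lambda>l. T (unit_seq l))"
    then have eq: "S (unit_seq l) = T (unit_seq l)" for l by metis
    have Sb: "bounded_operator (ell 1) Y S" and Tb: "bounded_operator (ell 1) Y T"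
      using S T by (simp_all add: in_operator_space)
    have "S v = T v" if v: "v \<in> nv_carrier (ell 1)" for v
      using functional_eq_if_eq_on_units[OF Sb Tb _ eq v]
      by (intro sep bounded_operatorD(1)[OF Sb v] bounded_operatorD(1)[OF Tb v])
    then show "S = T" using S T by (auto simp: in_operator_space intro: extensionalityI)
  qed
  then have "?C \<lesssim> (UNIV :: (nat \<Rightarrow> 'w) set)" unfolding lepoll_def by blast
  also have "\<dots> \<lesssim> (UNIV :: nat set set)" by (rule fun_nat_lepoll_nat_sets[OF w])
  also have "\<dots> \<approx> (UNIV :: real set)" by (rule nat_sets_eqpoll_reals)
  finally obtain g :: "_ \<Rightarrow> real" where "inj_on g ?C" by (auto simp: lepoll_def)
  then have "inj_on (image g) (Pow ?C)" by (rule inj_on_image_Pow)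
  then have "Pow ?C \<lesssim> Pow (UNIV :: real set)" unfolding lepoll_def by blast
  moreover have "closed_ideals (ell 1) Y \<subseteq> Pow ?C"
    by (auto simp: closed_ideals_def linear_subspace_def)
  ultimately show ?thesis using subset_imp_lepoll lepoll_trans by blast
qed

lemma closed_ideals_ell_eqpoll:
  assumes k: "(UNIV :: 'k::{real_normed_field, banach} set) \<lesssim> (UNIV :: nat set set)" and q: "1 < q"
  shows "closed_ideals (ell 1 :: ('k, nat \<Rightarrow> 'k) nspace) (ell q) \<approx> Pow (UNIV :: real set)"
proof (rule lepoll_antisym)
  show "Pow (UNIV :: real set) \<lesssim> closed_ideals (ell 1 :: ('k, nat \<Rightarrow> 'k) nspace) (ell q)"
    by (rule Pow_real_lepoll_closed_ideals_if_coordinates[OF coordinate_space_ell[OF q]])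
  show "closed_ideals (ell 1 :: ('k, nat \<Rightarrow> 'k) nspace) (ell q) \<lesssim> Pow (UNIV :: real set)"
  proof (rule closed_ideals_lepoll_Pow_real[OF fun_nat_lepoll_nat_sets[OF k]])
    fix y z :: "nat \<Rightarrow> 'k"
    assume "\<And>f. bounded_functional (ell q) 1 f \<Longrightarrow> f y = f z"
    moreover have "bounded_functional (ell q) 1 (\<lambda>y :: nat \<Rightarrow> 'k. y i)" for i
      using q ell_coordinate_le[of q] by (auto simp: bounded_functional_def ell_simps(2,3))
    ultimately show "y = z" by (metis ext)
  qed
qed

lemma closed_ideals_c0_sum_eqpoll:
  assumes k: "(UNIV :: 'k::{real_normed_field, banach} set) \<lesssim> (UNIV :: nat set set)"
  shows "closed_ideals (ell 1 :: ('k, nat \<Rightarrow> 'k) nspace) (c0_sum (\<lambda>n. ell2_fin (Suc n))) \<approx> Pow (UNIV :: real set)"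
    (is "closed_ideals _ ?E \<approx> _")
proof (rule lepoll_antisym)
  show "Pow (UNIV :: real set) \<lesssim> closed_ideals (ell 1) ?E"
    by (rule Pow_real_lepoll_closed_ideals_if_coordinates[OF coordinate_space_c0_sum])
  show "closed_ideals (ell 1) ?E \<lesssim> Pow (UNIV :: real set)"
  \<comment> \<open>Vectors are sequences of sequences of scalars, hence two passages to sequences.
    Points are separated by the coordinates below the dimension; the padding beyond is 0 in every
    vector.\<close>
  proof (rule closed_ideals_lepoll_Pow_real[OF fun_nat_lepoll_nat_sets[OF fun_nat_lepoll_nat_sets[OF k]]])
    fix y z :: "nat \<Rightarrow> nat \<Rightarrow> 'k"
    assume yz: "y \<in> nv_carrier ?E" "z \<in> nv_carrier ?E"
      and eq: "\<And>f. bounded_functional ?E 1 f \<Longrightarrow> f y = f z"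
    have "bounded_functional ?E 1 (\<lambda>y. y n c)" if c: "c < Suc n" for n c
      unfolding bounded_functional_def
    proof (intro conjI ballI allI)
      fix u :: "nat \<Rightarrow> nat \<Rightarrow> 'k" assume u: "u \<in> nv_carrier ?E"
      have "norm (u n c) \<le> nv_norm (ell2_fin (Suc n)) (u n)"
        using member_le_L2_set[of "{..<Suc n}" c "\<lambda>i. norm (u n i)"] c by (simp add: ell2_fin_simps)
      also have "\<dots> \<le> nv_norm ?E u" by (rule c0_sum_block_le[OF u])
      finally show "norm (u n c) \<le> 1 * nv_norm ?E u" by simp
    qed (simp_all add: c0_sum_simps ell2_fin_simps)
    then have "y n c = z n c" if "c < Suc n" for n c using eq that by blast
    moreover have "y n c = z n c" if "\<not> c < Suc n" for n c
      using yz that by (simp add: c0_sum_simps ell2_fin_simps)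
    ultimately show "y = z" by (intro ext) blast
  qed
qed

text \<open>Both real and complex scalars are covered; besides the type classes, they enter through
  the bound of their cardinality by the continuum. \<open>ell2_fin (Suc n)\<close> lets the
  dimensions start at 1, and \<open>Pow (UNIV :: real set)\<close> represents the power set of the
  continuum.\<close>

theorem mainTheorem2:
  shows "(\<forall>q::real. 1 < q \<longrightarrow>
            closed_ideals (ell 1 :: (real, nat \<Rightarrow> real) nspace) (ell q) \<approx> Pow (UNIV :: real set) \<and>
            closed_ideals (ell 1 :: (complex, nat \<Rightarrow> complex) nspace) (ell q) \<approx> Pow (UNIV :: real set)) \<and>
         closed_ideals (ell 1 :: (real, nat \<Rightarrow> real) nspace) (c0_sum (\<lambda>n. ell2_fin (Suc n)))
           \<approx> Pow (UNIV :: real set) \<and>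
         closed_ideals (ell 1 :: (complex, nat \<Rightarrow> complex) nspace) (c0_sum (\<lambda>n. ell2_fin (Suc n)))
           \<approx> Pow (UNIV :: real set)"
proof -
  have real: "(UNIV :: real set) \<lesssim> (UNIV :: nat set set)"
    using nat_sets_eqpoll_reals eqpoll_sym eqpoll_imp_lepoll by blast
  have "inj (\<lambda>z n :: nat. if n = 0 then Re z else Im z)"
    by (rule injI) (metis complex_eqI one_neq_zero)
  then have "(UNIV :: complex set) \<lesssim> (UNIV :: (nat \<Rightarrow> real) set)"
    unfolding lepoll_def by blast
  then have complex: "(UNIV :: complex set) \<lesssim> (UNIV :: nat set set)"
    using fun_nat_lepoll_nat_sets[OF real] lepoll_trans by blast
  show ?thesis
    by (intro conjI allI impI closed_ideals_ell_eqpoll closed_ideals_c0_sum_eqpoll real complex)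
qed

end
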